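(* Let $n$ be a positive integer and let $\mathrm{rec}:\{-1,1\}^n\to\{-1,1\}^n$, $\mathrm{rec}(x)=x$. Then the following bounds hold. (1) Bounded-size sets: for every integer $1\le k\le n$, if $\mathcal{Q}=\{S\subseteq[n]:|S|\le k\}$, then $\mathsf{Q}^{\mathcal{Q}}(\mathrm{rec})=\Theta(n/\sqrt{k})$. (2) Contiguous blocks: if $\mathcal{Q}=\{[i,j]: i\le j\in[n]\}$, then $\mathsf{Q}^{\mathcal{Q}}(\mathrm{rec})=\widetilde{\Theta}(n)$. (3) Prefixes: if $\mathcal{Q}=\{[1,i]: i\in[n]\}$, then $\mathsf{Q}^{\mathcal{Q}}(\mathrm{rec})=\Theta(n)$. (4) Only the full set: if $\mathcal{Q}=\{[n]\}$, then $\mathsf{Q}^{\mathcal{Q}}(\mathrm{rec})=\Theta(2^{n/2})$. Here the constants implicit in $\Theta$ are absolute (independent of $n$ and $k$), and $\widetilde\Theta$ hides factors polylogarithmic in $n$.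
   Context: $[n]=\{1,\dots,n\}$ and $[i,j]=\{m\in[n]: i\le m\le j\}$. Query model: for $\mathcal{Q}\subseteq 2^{[n]}$, a query is a pair $(S,b)$ with $S\in\mathcal{Q}$, $b\in\{-1,1\}^S$; its answer on hidden input $x\in\{-1,1\}^n$ is $\mathbb{I}[x_S=b]\in\{0,1\}$, where $x_S$ is the restriction of $x$ to the coordinates in $S$. A quantum algorithm making $T$ queries prepares $U_TO_xU_{T-1}\cdots U_1O_xU_0|\psi_0\rangle$ on a finite-dimensional space (query register, answer qubit, workspace), where $|\psi_0\rangle$ and the unitaries $U_i$ do not depend on $x$ and $O_x:|S,b\rangle|a\rangle|w\rangle\mapsto|S,b\rangle|a+\mathbb{I}[x_S=b] \bmod 2\rangle|w\rangle$; it then measures to produce an output. For a function $F:\{-1,1\}^n\to E$, $\mathsf{Q}^{\mathcal{Q}}(F)$ is the least $T$ for which some such algorithm outputs $F(x)$ with probability at least $2/3$ for every $x$. *)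

theory Defs
  imports "HOL-Analysis.Analysis"
begin

section \<open>Finite-dimensional Hilbert spaces with a named basis\<close>

text \<open>
  The algorithm may use a workspace of any finite dimension, and the basis of the query register
  depends on the family of allowed queries, so the dimension cannot be a type.  We use the Hilbert
  space with orthonormal basis indexed by a finite set \<open>B\<close>: a vector is a function on \<open>B\<close>, and a
  linear operator is a matrix with row index first.  Values outside \<open>B\<close> are never inspected, and
  \<open>mat_app\<close> returns 0 there.
\<close>

type_synonym 'b vector = "'b \<Rightarrow> complex"
type_synonym 'b operator = "'b \<Rightarrow> 'b \<Rightarrow> complex"

definition mat_app :: "'b set \<Rightarrow> 'b operator \<Rightarrow> 'b vector \<Rightarrow> 'b vector" where
  "mat_app B M \<psi> = (\<lambda>v. if v \<in> B then (\<Sum>u\<in>B. M v u * \<psi> u) else 0)"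

definition mat_mult :: "'b set \<Rightarrow> 'b operator \<Rightarrow> 'b operator \<Rightarrow> 'b operator" where
  "mat_mult B M N = (\<lambda>v u. \<Sum>w\<in>B. M v w * N w u)"

definition adj :: "'b operator \<Rightarrow> 'b operator" where
  "adj M = (\<lambda>v u. cnj (M u v))"

definition norm_sq :: "'b set \<Rightarrow> 'b vector \<Rightarrow> real" where
  "norm_sq B \<psi> = (\<Sum>v\<in>B. (cmod (\<psi> v))\<^sup>2)"

definition is_identity :: "'b set \<Rightarrow> 'b operator \<Rightarrow> bool" where
  "is_identity B M \<longleftrightarrow> (\<forall>v\<in>B. \<forall>u\<in>B. M v u = (if v = u then 1 else 0))"

definition unitary :: "'b set \<Rightarrow> 'b operator \<Rightarrow> bool" where
  "unitary B U \<longleftrightarrow> is_identity B (mat_mult B (adj U) U) \<and> is_identity B (mat_mult B U (adj U))"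

text \<open>
  A quantum measurement with outcome set \<open>E\<close> is given by measurement operators \<open>K e\<close> satisfying the
  completeness relation (the sum over \<open>e \<in> E\<close> of \<open>adj (K e) * K e\<close> is the identity); outcome \<open>e\<close>
  on the state \<open>\<psi>\<close> has probability the squared norm of \<open>K e \<psi>\<close>.  Projective measurements, and
  measurements in the computational basis followed by classical post-processing, are special cases.
\<close>

definition measurement :: "'b set \<Rightarrow> 'e set \<Rightarrow> ('e \<Rightarrow> 'b operator) \<Rightarrow> bool" where
  "measurement B E K \<longleftrightarrow>
     finite E \<and> is_identity B (\<lambda>v u. \<Sum>e\<in>E. mat_mult B (adj (K e)) (K e) v u)"

definition outcome_prob :: "'b set \<Rightarrow> ('e \<Rightarrow> 'b operator) \<Rightarrow> 'b vector \<Rightarrow> 'e \<Rightarrow> real" where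
  "outcome_prob B K \<psi> e = norm_sq B (mat_app B (K e) \<psi>)"

section \<open>The query model\<close>

text \<open>
  Strings indexed by a set \<open>S\<close> of coordinates are extensional functions (\<open>undefined\<close> outside \<open>S\<close>), so
  that equality of \<open>restrict x S\<close> and \<open>b\<close> is equality as elements of \<open>{-1,1}^S\<close>.
\<close>

definition sign_strings :: "nat set \<Rightarrow> (nat \<Rightarrow> int) set" where
  "sign_strings S = S \<rightarrow>\<^sub>E {-1, 1}"

definition answer :: "(nat \<Rightarrow> int) \<Rightarrow> nat set \<Rightarrow> (nat \<Rightarrow> int) \<Rightarrow> nat" where
  "answer x S b = (if restrict x S = b then 1 else 0)"

text \<open>Basis states: a query \<open>(S, b)\<close>, an answer bit, and one of \<open>d\<close> workspace basis states.\<close>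

type_synonym basis_state = "(nat set \<times> (nat \<Rightarrow> int)) \<times> nat \<times> nat"

definition basis_states :: "nat set set \<Rightarrow> nat \<Rightarrow> basis_state set" where
  "basis_states \<Q> d = (SIGMA S:\<Q>. sign_strings S) \<times> {0, 1} \<times> {..<d}"

fun query_map :: "(nat \<Rightarrow> int) \<Rightarrow> basis_state \<Rightarrow> basis_state" where
  "query_map x ((S, b), a, w) = ((S, b), (a + answer x S b) mod 2, w)"

definition query_op :: "(nat \<Rightarrow> int) \<Rightarrow> basis_state operator" where
  "query_op x = (\<lambda>v u. if v = query_map x u then 1 else 0)"

primrec run :: "basis_state set \<Rightarrow> (nat \<Rightarrow> basis_state operator) \<Rightarrow> basis_state vector
    \<Rightarrow> (nat \<Rightarrow> int) \<Rightarrow> nat \<Rightarrow> basis_state vector" where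
  "run B U \<psi>\<^sub>0 x 0 = mat_app B (U 0) \<psi>\<^sub>0"
| "run B U \<psi>\<^sub>0 x (Suc t) = mat_app B (U (Suc t)) (mat_app B (query_op x) (run B U \<psi>\<^sub>0 x t))"

definition computes_in ::
    "nat \<Rightarrow> nat set set \<Rightarrow> 'e set \<Rightarrow> ((nat \<Rightarrow> int) \<Rightarrow> 'e) \<Rightarrow> nat \<Rightarrow> bool" where
  "computes_in n \<Q> E F T \<longleftrightarrow>
     (\<exists>d \<psi>\<^sub>0 U K.
        norm_sq (basis_states \<Q> d) \<psi>\<^sub>0 = 1 \<and>
        (\<forall>t\<le>T. unitary (basis_states \<Q> d) (U t)) \<and>
        measurement (basis_states \<Q> d) E K \<and>
        (\<forall>x\<in>sign_strings {1..n}.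
           outcome_prob (basis_states \<Q> d) K (run (basis_states \<Q> d) U \<psi>\<^sub>0 x T) (F x) \<ge> 2 / 3))"

text \<open>
  Meant for \<open>\<Q>\<close> a family of subsets of \<open>{1..n}\<close> and \<open>F\<close> mapping \<open>sign_strings {1..n}\<close> into the finite
  set \<open>E\<close>.  The value is \<open>\<infinity>\<close> if no algorithm works, whatever the number of queries.
\<close>

definition quantum_query_complexity ::
    "nat \<Rightarrow> nat set set \<Rightarrow> 'e set \<Rightarrow> ((nat \<Rightarrow> int) \<Rightarrow> 'e) \<Rightarrow> enat" where
  "quantum_query_complexity n \<Q> E F = Inf (enat ` {T. computes_in n \<Q> E F T})"

definition Q_rec :: "nat \<Rightarrow> nat set set \<Rightarrow> ereal" where
  "Q_rec n \<Q> =
     ereal_of_enat (quantum_query_complexity n \<Q> (sign_strings {1..n}) (\<lambda>x. x))"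

end

theory Submission
  imports Defs
begin

text \<open>
  Lower bounds: give every pair \<open>(x, y)\<close> of inputs a weight and follow the weighted sum of the squared
  distances between the states reached on \<open>x\<close> and on \<open>y\<close>.  It starts at 0, must end proportional to
  the total weight, and one query increases it by at most a Schur-test bound on the part of the weight
  matrix that the query separates.  Reconstruction is hard for the weights that join strings differing in
  one block of coordinates (single bits, blocks of logarithmic length, the whole string), and for prefixes
  for a weight doubling with the position of the first difference.

  Upper bounds: a feasible point of the dual adversary program is turned into an algorithm by using it as a
  catalyst.  Blocks of coordinates are learnt one after another, so that their costs add up without any loss
  from error reduction.  Inside a block of size \<open>k\<close> the witness queries a random set \<open>S\<close> with all
  possible answers and is supported on answers at Hamming distance at most 1 from the truth; its cost is of
  order \<open>sqrt k\<close>.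
\<close>

section \<open>Operators with a named basis\<close>

text \<open>Three of the four lower bounds use one weight family with two parameters, a block length
  \<open>L\<close> and a ratio \<open>a\<close>. A query containing whole blocks costs
  \<open>a\<close> per block on strings that match it and \<open>1 / (2 ^ L * a)\<close> on the
  others; a block that is merely cut costs 1. Single bits are never cut, and
  \<open>a = 1 / sqrt k\<close> balances the two sides. The whole string is one block, with a =
  2^(-n/2). An interval can contain linearly many blocks, so single bits would give only order sqrt
  n; but it cuts at most two. Blocks slightly longer than log2 n therefore make the contained blocks
  cost at most 1 in total, and their number, of order n / log n, becomes the bound. For prefixes
  this would lose the same logarithm. Doubling the weight with the position gives every first
  difference the same total weight, while a prefix query meets only a geometric series. The
  logarithm is thus lost only in the lower bound for intervals; their upper bound is linear and
  queries singletons alone.\<close>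

definition inner_prod :: "'b set \<Rightarrow> 'b vector \<Rightarrow> 'b vector \<Rightarrow> complex" where
  "inner_prod B \<phi> \<psi> = (\<Sum>v\<in>B. cnj (\<phi> v) * \<psi> v)"

lemma inner_prod_cong:
  "(\<And>v. v \<in> B \<Longrightarrow> \<phi> v = \<phi>' v) \<Longrightarrow> (\<And>v. v \<in> B \<Longrightarrow> \<psi> v = \<psi>' v) \<Longrightarrow>
    inner_prod B \<phi> \<psi> = inner_prod B \<phi>' \<psi>'"
  by (simp add: inner_prod_def)

lemma norm_sq_inner_prod: "complex_of_real (norm_sq B \<psi>) = inner_prod B \<psi> \<psi>"
  by (simp add: norm_sq_def inner_prod_def complex_norm_square mult.commute del: of_real_power)

lemma inner_prod_commute: "inner_prod B \<psi> \<phi> = cnj (inner_prod B \<phi> \<psi>)"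
  by (simp add: inner_prod_def mult.commute)

lemma inner_prod_diff_left: "inner_prod B (\<lambda>v. \<phi> v - \<phi>' v) \<psi> = inner_prod B \<phi> \<psi> - inner_prod B \<phi>' \<psi>"
  by (simp add: inner_prod_def left_diff_distrib sum_subtractf)

lemma inner_prod_diff_right: "inner_prod B \<psi> (\<lambda>v. \<phi> v - \<phi>' v) = inner_prod B \<psi> \<phi> - inner_prod B \<psi> \<phi>'"
  by (simp add: inner_prod_def right_diff_distrib sum_subtractf)

text \<open>Completeness says that the operators \<open>K e\<close>, stacked on top of each other,
  form an isometry. A unitary is the case of a single outcome, which is how its invariance
  properties are obtained below.\<close>

lemma measurement_inner_prod:
  assumes "finite B" and K: "measurement B E K"
  shows "(\<Sum>e\<in>E. inner_prod B (mat_app B (K e) \<phi>) (mat_app B (K e) \<psi>)) = inner_prod B \<phi> \<psi>"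
proof -
  have I: "(\<Sum>e\<in>E. \<Sum>w\<in>B. cnj (K e w v) * K e w u) = (if v = u then 1 else 0)"
    if "v \<in> B" "u \<in> B" for v u
    using K that by (auto simp: measurement_def is_identity_def mat_mult_def adj_def)
  have "(\<Sum>e\<in>E. inner_prod B (mat_app B (K e) \<phi>) (mat_app B (K e) \<psi>)) =
      (\<Sum>e\<in>E. \<Sum>w\<in>B. \<Sum>v\<in>B. \<Sum>u\<in>B. cnj (\<phi> v) * \<psi> u * (cnj (K e w v) * K e w u))"
    unfolding inner_prod_def mat_app_def
    by (intro sum.cong refl) (simp add: sum_product, intro sum.cong refl, simp add: mult_ac)
  also have "\<dots> = (\<Sum>(e, w)\<in>E \<times> B. \<Sum>(v, u)\<in>B \<times> B. cnj (\<phi> v) * \<psi> u * (cnj (K e w v) * K e w u))"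
    by (simp flip: sum.cartesian_product)
  also have "\<dots> = (\<Sum>(v, u)\<in>B \<times> B. cnj (\<phi> v) * \<psi> u * (\<Sum>(e, w)\<in>E \<times> B. cnj (K e w v) * K e w u))"
    unfolding case_prod_unfold sum_distrib_left by (rule sum.swap)
  also have "\<dots> = (\<Sum>v\<in>B. \<Sum>u\<in>B. cnj (\<phi> v) * \<psi> u * (\<Sum>e\<in>E. \<Sum>w\<in>B. cnj (K e w v) * K e w u))"
    by (simp flip: sum.cartesian_product)
  also have "\<dots> = (\<Sum>v\<in>B. \<Sum>u\<in>B. if v = u then cnj (\<phi> v) * \<psi> u else 0)"
    by (intro sum.cong refl) (simp add: I)
  also have "\<dots> = inner_prod B \<phi> \<psi>"
    using assms(1) by (simp add: inner_prod_def)
  finally show ?thesis .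
qed

lemma measurement_total:
  assumes "finite B" "measurement B E K"
  shows "(\<Sum>e\<in>E. outcome_prob B K \<psi> e) = norm_sq B \<psi>"
proof -
  have "complex_of_real (\<Sum>e\<in>E. outcome_prob B K \<psi> e) = of_real (norm_sq B \<psi>)"
    by (simp add: outcome_prob_def norm_sq_inner_prod measurement_inner_prod[OF assms])
  thus ?thesis by (simp only: of_real_eq_iff)
qed

lemma unitary_inner_prod:
  assumes "finite B" "unitary B U"
  shows "inner_prod B (mat_app B U \<phi>) (mat_app B U \<psi>) = inner_prod B \<phi> \<psi>"
  using measurement_inner_prod[of B "{()}" "\<lambda>_. U"] assms
  by (simp add: measurement_def unitary_def)

lemma unitary_norm_sq:
  assumes "finite B" "unitary B U"
  shows "norm_sq B (mat_app B U \<psi>) = norm_sq B \<psi>"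
  using measurement_total[of B "{()}" "\<lambda>_. U" \<psi>] assms
  by (simp add: measurement_def unitary_def outcome_prob_def)

lemma mat_app_diff:
  "mat_app B M (\<lambda>v. \<phi> v - \<psi> v) = (\<lambda>v. mat_app B M \<phi> v - mat_app B M \<psi> v)"
  by (auto simp: mat_app_def sum_subtractf right_diff_distrib)

lemma norm_sq_nonneg: "norm_sq B \<psi> \<ge> 0"
  by (simp add: norm_sq_def sum_nonneg)

lemma norm_sq_cong: "(\<And>v. v \<in> B \<Longrightarrow> \<phi> v = \<psi> v) \<Longrightarrow> norm_sq B \<phi> = norm_sq B \<psi>"
  by (simp add: norm_sq_def)

lemma mat_mult_assoc: "mat_mult B (mat_mult B L M) N = mat_mult B L (mat_mult B M N)"
  by (intro ext, simp add: mat_mult_def sum_distrib_left sum_distrib_right mult.assoc, subst sum.swap, rule refl)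

lemma mat_mult_id_left:
  assumes "finite B" "is_identity B I" "v \<in> B"
  shows "mat_mult B I M v u = M v u"
proof -
  have "mat_mult B I M v u = (\<Sum>w\<in>B. if v = w then M w u else 0)"
    unfolding mat_mult_def by (intro sum.cong refl) (use assms in \<open>auto simp: is_identity_def\<close>)
  thus ?thesis using assms by simp
qed

lemma mat_app_mult:
  assumes "v \<in> B"
  shows "mat_app B (mat_mult B M N) \<psi> v = mat_app B M (mat_app B N \<psi>) v"
proof -
  have "mat_app B (mat_mult B M N) \<psi> v = (\<Sum>u\<in>B. \<Sum>w\<in>B. M v w * (N w u * \<psi> u))"
    using assms by (simp add: mat_app_def mat_mult_def sum_distrib_right mult.assoc)
  also have "\<dots> = (\<Sum>w\<in>B. \<Sum>u\<in>B. M v w * (N w u * \<psi> u))"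
    by (rule sum.swap)
  finally show ?thesis
    using assms by (simp add: mat_app_def sum_distrib_left)
qed

lemma adj_mat_mult: "adj (mat_mult B M N) = mat_mult B (adj N) (adj M)"
  by (auto simp: adj_def mat_mult_def mult.commute)

lemma adj_adj: "adj (adj M) = M"
  by (simp add: adj_def)

lemma unitary_mult:
  assumes B: "finite B" and U: "unitary B U" and V: "unitary B V"
  shows "unitary B (mat_mult B U V)"
proof -
  have *: "is_identity B (mat_mult B (mat_mult B (adj N) (adj M)) (mat_mult B M N))"
    if M: "is_identity B (mat_mult B (adj M) M)" and N: "is_identity B (mat_mult B (adj N) N)" for M N
  proof -
    have "mat_mult B (mat_mult B (adj N) (adj M)) (mat_mult B M N) v u =
        mat_mult B (adj N) (mat_mult B (mat_mult B (adj M) M) N) v u" for v u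
      by (simp add: mat_mult_assoc)
    also have "\<dots> v u = mat_mult B (adj N) N v u" for v u
      unfolding mat_mult_def[of B "adj N"]
      by (intro sum.cong refl) (simp add: mat_mult_id_left[OF B M])
    finally show ?thesis using N by (simp add: is_identity_def)
  qed
  show ?thesis
    using *[of U V] *[of "adj V" "adj U"] U V
    by (simp add: unitary_def adj_mat_mult adj_adj)
qed

text \<open>A generalised Householder reflection: it fixes the complement of \<open>d\<close> and
  multiplies \<open>d\<close> by a phase. Allowing a complex \<open>c\<close>, and so phases other
  than -1, is needed to move a vector to another of equal norm when their inner product is not
  real.\<close>

definition reflection :: "complex \<Rightarrow> 'b vector \<Rightarrow> 'b operator" where
  "reflection c d = (\<lambda>v u. (if v = u then 1 else 0) - c * d v * cnj (d u))"

lemma mat_app_reflection: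
  assumes "finite B" "v \<in> B"
  shows "mat_app B (reflection c d) \<psi> v = \<psi> v - c * d v * inner_prod B d \<psi>"
proof -
  have "mat_app B (reflection c d) \<psi> v =
      (\<Sum>u\<in>B. (if v = u then \<psi> u else 0) - c * d v * (cnj (d u) * \<psi> u))"
    using assms by (auto simp: mat_app_def reflection_def algebra_simps intro!: sum.cong)
  also have "\<dots> = (\<Sum>u\<in>B. (if v = u then \<psi> u else 0)) - c * d v * inner_prod B d \<psi>"
    by (simp only: sum_subtractf inner_prod_def sum_distrib_left)
  finally show ?thesis using assms by simp
qed

lemma unitary_reflection:
  assumes B: "finite B" and c: "c + cnj c = c * cnj c * of_real (norm_sq B d)"
  shows "unitary B (reflection c d)"
proof -
  have *: "mat_mult B (reflection (cnj c) d) (reflection c d) v u = (if v = u then 1 else 0)"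
    if c: "c + cnj c = c * cnj c * of_real (norm_sq B d)" and vu: "v \<in> B" "u \<in> B" for c v u
  proof -
    have "mat_mult B (reflection (cnj c) d) (reflection c d) v u =
        mat_app B (reflection (cnj c) d) (\<lambda>w. reflection c d w u) v"
      using vu by (simp add: mat_mult_def mat_app_def)
    also have "\<dots> = reflection c d v u - cnj c * d v * inner_prod B d (\<lambda>w. reflection c d w u)"
      using B vu by (simp add: mat_app_reflection)
    also have "inner_prod B d (\<lambda>w. reflection c d w u) =
        (\<Sum>w\<in>B. (if w = u then cnj (d w) else 0) - c * cnj (d u) * (cnj (d w) * d w))"
      by (auto simp: inner_prod_def reflection_def algebra_simps intro!: sum.cong)
    also have "\<dots> = (\<Sum>w\<in>B. (if w = u then cnj (d w) else 0)) - c * cnj (d u) * inner_prod B d d"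
      by (simp only: sum_subtractf inner_prod_def sum_distrib_left)
    also have "\<dots> = cnj (d u) - c * cnj (d u) * of_real (norm_sq B d)"
      using B vu by (simp add: norm_sq_inner_prod)
    also have "reflection c d v u - cnj c * d v * (cnj (d u) - c * cnj (d u) * of_real (norm_sq B d)) =
        (if v = u then 1 else 0) - d v * cnj (d u) * (c + cnj c - c * cnj c * of_real (norm_sq B d))"
      by (simp add: reflection_def algebra_simps)
    finally show ?thesis using c by simp
  qed
  have "adj (reflection c d) = reflection (cnj c) d"
    by (intro ext) (simp add: adj_def reflection_def)
  thus ?thesis
    using *[OF c] *[of "cnj c"] c
    by (auto simp: unitary_def is_identity_def add.commute mult.commute)
qed

lemma norm_sq_eq_0_iff: "finite B \<Longrightarrow> norm_sq B \<psi> = 0 \<longleftrightarrow> (\<forall>v\<in>B. \<psi> v = 0)"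
  by (simp add: norm_sq_def sum_nonneg_eq_0_iff)

lemma unitary_id: "finite B \<Longrightarrow> unitary B (\<lambda>v u. if v = u then 1 else 0)"
  using unitary_reflection[of B 0 "\<lambda>_. 0"] by (simp add: reflection_def)

text \<open>The vectors are matched one at a time. Once \<open>U\<close> is right on
  \<open>X\<close>, a reflection along the remaining error \<open>d\<close> corrects the new vector;
  equality of the Gram matrices makes \<open>d\<close> orthogonal to every earlier
  \<open>g y\<close>, so nothing already matched is moved.\<close>

lemma equal_gram_unitary:
  assumes B: "finite B" and X: "finite X"
    and gram: "\<And>x y. x \<in> X \<Longrightarrow> y \<in> X \<Longrightarrow> inner_prod B (f x) (f y) = inner_prod B (g x) (g y)"
  shows "\<exists>U. unitary B U \<and> (\<forall>x\<in>X. \<forall>v\<in>B. mat_app B U (f x) v = g x v)"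
  using X gram
proof (induction X rule: finite_induct)
  case empty
  show ?case using unitary_id[OF B] by auto
next
  case (insert x X)
  then obtain U where U: "unitary B U" and Uf: "\<And>y v. y \<in> X \<Longrightarrow> v \<in> B \<Longrightarrow> mat_app B U (f y) v = g y v"
    by (metis insertCI)
  define \<alpha> where "\<alpha> = mat_app B U (f x)"
  define d where "d = (\<lambda>v. \<alpha> v - g x v)"
  define z where "z = inner_prod B d \<alpha>"
  have gy: "inner_prod B \<alpha> (g y) = inner_prod B (g x) (g y)" if "y \<in> X" for y
  proof -
    have "inner_prod B \<alpha> (g y) = inner_prod B \<alpha> (mat_app B U (f y))"
      using Uf[OF that] by (intro inner_prod_cong) auto
    thus ?thesis
      using that insert.prems[of x y] by (simp add: \<alpha>_def unitary_inner_prod[OF B U])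
  qed
  have gx: "inner_prod B \<alpha> \<alpha> = inner_prod B (g x) (g x)"
    using insert.prems[of x x] by (simp add: \<alpha>_def unitary_inner_prod[OF B U])
  \<comment> \<open>Equal norms give \<open>Re z = norm_sq B d / 2\<close>. Hence \<open>z\<close>
    is nonzero if \<open>d\<close> is, and \<open>c = 1 / z\<close> both meets the unitarity
    condition and sends \<open>\<alpha>\<close> to \<open>\<alpha> - d\<close>, which is
    \<open>g x\<close>.\<close>
  have z: "of_real (norm_sq B d) = z + cnj z"
    using inner_prod_commute[of B \<alpha> "g x"] inner_prod_commute[of B "g x" "g x"]
    by (simp add: norm_sq_inner_prod z_def d_def inner_prod_diff_left inner_prod_diff_right gx)
  show ?case
  proof (cases "norm_sq B d = 0")
    case True
    hence "\<forall>v\<in>B. mat_app B U (f x) v = g x v"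
      using B by (simp add: norm_sq_eq_0_iff d_def \<alpha>_def)
    thus ?thesis using U Uf by auto
  next
    case False
    hence z0: "z \<noteq> 0" using z by (auto simp: complex_eq_iff)
    define R where "R = reflection (1 / z) d"
    have "unitary B R"
      unfolding R_def using B z z0 by (intro unitary_reflection) (auto simp: field_simps)
    hence "unitary B (mat_mult B R U)"
      using B U by (intro unitary_mult)
    moreover have "mat_app B (mat_mult B R U) (f y) v = g y v" if "v \<in> B" "y \<in> insert x X" for y v
    proof (cases "y = x")
      case True
      thus ?thesis using that B z0
        by (simp add: mat_app_mult R_def mat_app_reflection z_def[symmetric] flip: \<alpha>_def)
           (simp add: d_def)
    next
      case False
      hence y: "y \<in> X" using that by auto
      have "mat_app B R (mat_app B U (f y)) v = mat_app B R (g y) v"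
        using Uf[OF y] by (simp add: mat_app_def)
      also have "\<dots> = g y v"
        using that B gy[OF y] by (simp add: R_def mat_app_reflection d_def inner_prod_diff_left)
      finally show ?thesis using that by (simp add: mat_app_mult)
    qed
    ultimately show ?thesis by blast
  qed
qed

section \<open>Queries, answers and the query operator on basis states\<close>

abbreviation queries :: "nat set set \<Rightarrow> (nat set \<times> (nat \<Rightarrow> int)) set" where
  "queries \<Q> \<equiv> SIGMA S:\<Q>. sign_strings S"

abbreviation ans :: "(nat \<Rightarrow> int) \<Rightarrow> nat set \<times> (nat \<Rightarrow> int) \<Rightarrow> nat" where
  "ans x q \<equiv> answer x (fst q) (snd q)"

lemma finite_sign_strings: "finite S \<Longrightarrow> finite (sign_strings S)"
  by (simp add: sign_strings_def finite_PiE)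

lemma finite_queries: "\<Q> \<subseteq> Pow {1..n} \<Longrightarrow> finite (queries \<Q>)"
  by (intro finite_SigmaI finite_sign_strings) (auto intro: finite_subset)

lemma finite_basis_states: "\<Q> \<subseteq> Pow {1..n} \<Longrightarrow> finite (basis_states \<Q> d)"
  by (simp add: basis_states_def finite_queries)

lemma ans_le_1: "ans x q = 0 \<or> ans x q = 1"
  by (simp add: answer_def)

lemma sum_basis_states:
  "(\<Sum>v\<in>basis_states \<Q> d. f v) = (\<Sum>q\<in>queries \<Q>. \<Sum>w<d. f (q, 0, w) + f (q, 1, w))"
proof -
  have "(\<Sum>v\<in>basis_states \<Q> d. f v) = (\<Sum>q\<in>queries \<Q>. \<Sum>a\<in>{0, 1}. \<Sum>w<d. f (q, a, w))"
    unfolding basis_states_def by (simp only: sum.cartesian_product) (simp only: case_prod_unfold prod.collapse)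
  thus ?thesis by (simp add: sum.distrib)
qed

lemma query_map_eq: "query_map x (q, a, w) = (q, (a + ans x q) mod 2, w)"
  by (cases q) simp

text \<open>\<open>query_map x\<close> is an involution on the basis, so the amplitudes are pulled
  back along the same map.\<close>

lemma mat_app_query_op:
  assumes \<Q>: "\<Q> \<subseteq> Pow {1..n}" and v: "q \<in> queries \<Q>" "a \<in> {0, 1}" "w < d"
  shows "mat_app (basis_states \<Q> d) (query_op x) \<psi> (q, a, w) = \<psi> (q, (a + ans x q) mod 2, w)"
proof -
  let ?B = "basis_states \<Q> d" and ?v = "(q, (a + ans x q) mod 2, w)"
  have "query_op x (q, a, w) u = (if u = ?v then 1 else 0)" if "u \<in> ?B" for u
  proof -
    obtain q' a' w' where u: "u = (q', a', w')" by (cases u)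
    have a': "a' = 0 \<or> a' = 1" "a = 0 \<or> a = 1"
      using that v by (auto simp: basis_states_def u)
    show ?thesis
      using ans_le_1[of x q] a' unfolding u query_op_def query_map_eq
      by (cases "q = q'"; cases "w = w'") (elim disjE; simp)+
  qed
  hence "mat_app ?B (query_op x) \<psi> (q, a, w) = (\<Sum>u\<in>?B. if u = ?v then \<psi> u else 0)"
    using v unfolding mat_app_def
    by (subst if_P, simp add: basis_states_def) (intro sum.cong refl, simp)
  moreover have "?v \<in> ?B" using v by (auto simp: basis_states_def)
  ultimately show ?thesis using finite_basis_states[OF \<Q>] by simp
qed

lemma norm_sq_query_op:
  assumes "\<Q> \<subseteq> Pow {1..n}"
  shows "norm_sq (basis_states \<Q> d) (mat_app (basis_states \<Q> d) (query_op x) \<psi>) = norm_sq (basis_states \<Q> d) \<psi>"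
  unfolding norm_sq_def sum_basis_states
proof (intro sum.cong refl)
  fix q w assume "q \<in> queries \<Q>" "w \<in> {..<d}"
  thus "(cmod (mat_app (basis_states \<Q> d) (query_op x) \<psi> (q, 0, w)))\<^sup>2
      + (cmod (mat_app (basis_states \<Q> d) (query_op x) \<psi> (q, 1, w)))\<^sup>2
      = (cmod (\<psi> (q, 0, w)))\<^sup>2 + (cmod (\<psi> (q, 1, w)))\<^sup>2"
    using ans_le_1[of x q] by (auto simp: mat_app_query_op[OF assms])
qed

section \<open>The weighted adversary lower bound\<close>

lemma abs_Re_mult_le:
  fixes p q :: complex
  assumes "h > 0"
  shows "2 * \<bar>Re (p * cnj q)\<bar> \<le> h * (cmod p)\<^sup>2 + (cmod q)\<^sup>2 / h"
proof -
  have "\<bar>Re (p * cnj q)\<bar> \<le> cmod p * cmod q"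
    using abs_Re_le_cmod[of "p * cnj q"] by (simp add: norm_mult)
  moreover have "0 \<le> (sqrt h * cmod p - cmod q / sqrt h)\<^sup>2" by simp
  hence "2 * (cmod p * cmod q) \<le> h * (cmod p)\<^sup>2 + (cmod q)\<^sup>2 / h"
    using assms by (simp add: power2_diff power_mult_distrib power_divide)
  ultimately show ?thesis by linarith
qed

lemma cmod_diff_sq: "(cmod (p - q))\<^sup>2 = (cmod p)\<^sup>2 + (cmod q)\<^sup>2 - 2 * Re (p * cnj q)"
  unfolding cmod_power2 by (simp add: power2_eq_square algebra_simps)

text \<open>Different answers swap the answer bits of the two states against each other. The squared
  norms on both sides cancel, leaving four real inner products, each bounded by weighted AM-GM with
  the free parameter \<open>h\<close>.\<close>

lemma flip_diff_le:
  fixes p q :: "nat \<Rightarrow> complex"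
  assumes "h > 0"
  shows "(cmod (p 1 - q 0))\<^sup>2 + (cmod (p 0 - q 1))\<^sup>2 \<le>
    (cmod (p 0 - q 0))\<^sup>2 + (cmod (p 1 - q 1))\<^sup>2 +
    2 * (h * ((cmod (p 0))\<^sup>2 + (cmod (p 1))\<^sup>2) + ((cmod (q 0))\<^sup>2 + (cmod (q 1))\<^sup>2) / h)"
proof -
  have *: "2 * Re (u * cnj v) \<le> h * (cmod u)\<^sup>2 + (cmod v)\<^sup>2 / h"
    "- 2 * Re (u * cnj v) \<le> h * (cmod u)\<^sup>2 + (cmod v)\<^sup>2 / h" for u v
    using abs_Re_mult_le[OF assms, of u v] by linarith+
  show ?thesis
    using *(1)[of "p 0" "q 0"] *(2)[of "p 0" "q 1"] *(2)[of "p 1" "q 0"] *(1)[of "p 1" "q 1"]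
    unfolding cmod_diff_sq distrib_left add_divide_distrib by linarith
qed

definition query_weight :: "nat \<Rightarrow> basis_state vector \<Rightarrow> nat set \<times> (nat \<Rightarrow> int) \<Rightarrow> real" where
  "query_weight d \<psi> q = (\<Sum>w<d. (cmod (\<psi> (q, 0, w)))\<^sup>2 + (cmod (\<psi> (q, 1, w)))\<^sup>2)"

lemma query_weight_nonneg: "query_weight d \<psi> q \<ge> 0"
  by (simp add: query_weight_def sum_nonneg)

lemma norm_sq_basis_states: "norm_sq (basis_states \<Q> d) \<psi> = (\<Sum>q\<in>queries \<Q>. query_weight d \<psi> q)"
  by (simp add: norm_sq_def sum_basis_states query_weight_def)

text \<open>Only queries answered differently can change the distance. The AM-GM ratio
  \<open>h q\<close> may be chosen for each query and each pair of strings; this freedom later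
  becomes the Schur test.\<close>

lemma query_op_distance:
  fixes d :: nat
  assumes \<Q>: "\<Q> \<subseteq> Pow {1..n}" and h: "\<And>q. q \<in> queries \<Q> \<Longrightarrow> ans x q \<noteq> ans y q \<Longrightarrow> h q > 0"
  defines "B \<equiv> basis_states \<Q> d"
  shows "norm_sq B (\<lambda>v. mat_app B (query_op x) \<phi> v - mat_app B (query_op y) \<psi> v) \<le>
    norm_sq B (\<lambda>v. \<phi> v - \<psi> v) + (\<Sum>q\<in>queries \<Q>. if ans x q \<noteq> ans y q
      then 2 * (h q * query_weight d \<phi> q + query_weight d \<psi> q / h q) else 0)"
proof -
  let ?\<Delta> = "\<lambda>v. mat_app B (query_op x) \<phi> v - mat_app B (query_op y) \<psi> v"
  have "query_weight d ?\<Delta> q \<le> query_weight d (\<lambda>v. \<phi> v - \<psi> v) q + (if ans x q \<noteq> ans y q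
      then 2 * (h q * query_weight d \<phi> q + query_weight d \<psi> q / h q) else 0)"
    if q: "q \<in> queries \<Q>" for q
  proof (cases "ans x q = ans y q")
    case True
    have "query_weight d ?\<Delta> q = query_weight d (\<lambda>v. \<phi> v - \<psi> v) q"
      unfolding query_weight_def
    proof (intro sum.cong refl)
      fix w assume w: "w \<in> {..<d}"
      show "(cmod (?\<Delta> (q, 0, w)))\<^sup>2 + (cmod (?\<Delta> (q, 1, w)))\<^sup>2 =
          (cmod (\<phi> (q, 0, w) - \<psi> (q, 0, w)))\<^sup>2 + (cmod (\<phi> (q, 1, w) - \<psi> (q, 1, w)))\<^sup>2"
        using ans_le_1[of y q] q w by (auto simp: True B_def mat_app_query_op[OF \<Q>])
    qed
    thus ?thesis using True by simp
  next
    case False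
    have "query_weight d ?\<Delta> q \<le> (\<Sum>w<d. ((cmod (\<phi> (q, 0, w) - \<psi> (q, 0, w)))\<^sup>2 + (cmod (\<phi> (q, 1, w) - \<psi> (q, 1, w)))\<^sup>2) +
       2 * (h q * ((cmod (\<phi> (q, 0, w)))\<^sup>2 + (cmod (\<phi> (q, 1, w)))\<^sup>2) + ((cmod (\<psi> (q, 0, w)))\<^sup>2 + (cmod (\<psi> (q, 1, w)))\<^sup>2) / h q))"
      unfolding query_weight_def
    proof (intro sum_mono)
      fix w assume w: "w \<in> {..<d}"
      have "(cmod (?\<Delta> (q, 0, w)))\<^sup>2 + (cmod (?\<Delta> (q, 1, w)))\<^sup>2 =
          (cmod (\<phi> (q, 1, w) - \<psi> (q, 0, w)))\<^sup>2 + (cmod (\<phi> (q, 0, w) - \<psi> (q, 1, w)))\<^sup>2"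
        using ans_le_1[of y q] ans_le_1[of x q] False q w by (auto simp: B_def mat_app_query_op[OF \<Q>])
      thus "(cmod (?\<Delta> (q, 0, w)))\<^sup>2 + (cmod (?\<Delta> (q, 1, w)))\<^sup>2 \<le>
        ((cmod (\<phi> (q, 0, w) - \<psi> (q, 0, w)))\<^sup>2 + (cmod (\<phi> (q, 1, w) - \<psi> (q, 1, w)))\<^sup>2) +
       2 * (h q * ((cmod (\<phi> (q, 0, w)))\<^sup>2 + (cmod (\<phi> (q, 1, w)))\<^sup>2) + ((cmod (\<psi> (q, 0, w)))\<^sup>2 + (cmod (\<psi> (q, 1, w)))\<^sup>2) / h q)"
        using flip_diff_le[OF h[OF q False], of "\<lambda>a. \<phi> (q, a, w)" "\<lambda>a. \<psi> (q, a, w)"] by linarith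
    qed
    also have "\<dots> = query_weight d (\<lambda>v. \<phi> v - \<psi> v) q + 2 * (h q * query_weight d \<phi> q + query_weight d \<psi> q / h q)"
      by (simp only: query_weight_def sum.distrib sum_distrib_left[symmetric] sum_divide_distrib[symmetric])
    finally show ?thesis using False by simp
  qed
  hence "(\<Sum>q\<in>queries \<Q>. query_weight d ?\<Delta> q) \<le> (\<Sum>q\<in>queries \<Q>. query_weight d (\<lambda>v. \<phi> v - \<psi> v) q) +
      (\<Sum>q\<in>queries \<Q>. if ans x q \<noteq> ans y q
        then 2 * (h q * query_weight d \<phi> q + query_weight d \<psi> q / h q) else 0)"
    unfolding sum.distrib[symmetric] by (rule sum_mono)
  thus ?thesis
    by (simp only: B_def norm_sq_basis_states)
qed

lemma norm_sq_run:
  assumes \<Q>: "\<Q> \<subseteq> Pow {1..n}" and "norm_sq (basis_states \<Q> d) \<psi>\<^sub>0 = 1"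
    and "\<And>t. t \<le> T \<Longrightarrow> unitary (basis_states \<Q> d) (U t)" and "t \<le> T"
  shows "norm_sq (basis_states \<Q> d) (run (basis_states \<Q> d) U \<psi>\<^sub>0 x t) = 1"
  using assms(4)
  by (induction t) (simp_all add: assms(2,3) unitary_norm_sq finite_basis_states[OF \<Q>] norm_sq_query_op[OF \<Q>])

text \<open>AM-GM with ratio 7/10: the factors are 1 - 7/10 and 1 - 10/7. They suit success
  probability 2/3: the two outcomes in \<open>distinguishable_distance\<close> give twice 3/10 * 2/3
  - 3/7 * 1/3, that is 4/35, which exceeds 1/10.\<close>

lemma norm_sq_diff_ge:
  "norm_sq B (\<lambda>v. \<phi> v - \<psi> v) \<ge> 3 / 10 * norm_sq B \<phi> - 3 / 7 * norm_sq B \<psi>"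
proof -
  have *: "(cmod (p - r))\<^sup>2 \<ge> 3 / 10 * (cmod p)\<^sup>2 - 3 / 7 * (cmod r)\<^sup>2" for p r
  proof -
    have "2 * \<bar>Re (p * cnj r)\<bar> \<le> 7 / 10 * (cmod p)\<^sup>2 + 10 / 7 * (cmod r)\<^sup>2"
      using abs_Re_mult_le[of "7 / 10" p r] by simp
    thus ?thesis unfolding cmod_diff_sq by linarith
  qed
  show ?thesis
    unfolding norm_sq_def sum_distrib_left sum_subtractf[symmetric] by (intro sum_mono *)
qed

text \<open>The squared distance is the total outcome weight of the difference vector, so a bound on
  the outcomes \<open>e\<close> and \<open>e'\<close> alone suffices. On each state the wrong one of
  the two has probability at most 1/3.\<close>

lemma distinguishable_distance:
  assumes B: "finite B" and K: "measurement B E K" and E: "e \<in> E" "e' \<in> E" "e \<noteq> e'"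
    and "norm_sq B \<phi> = 1" "norm_sq B \<psi> = 1"
    and "outcome_prob B K \<phi> e \<ge> 2 / 3" "outcome_prob B K \<psi> e' \<ge> 2 / 3"
  shows "norm_sq B (\<lambda>v. \<phi> v - \<psi> v) \<ge> 1 / 10"
proof -
  have two: "outcome_prob B K \<eta> e + outcome_prob B K \<eta> e' \<le> norm_sq B \<eta>" for \<eta>
  proof -
    have "(\<Sum>i\<in>{e, e'}. outcome_prob B K \<eta> i) \<le> (\<Sum>i\<in>E. outcome_prob B K \<eta> i)"
      using K E by (intro sum_mono2) (auto simp: measurement_def outcome_prob_def norm_sq_nonneg)
    thus ?thesis using E by (simp add: measurement_total[OF B K])
  qed
  have "outcome_prob B K (\<lambda>v. \<phi> v - \<psi> v) e \<ge> 3 / 10 * outcome_prob B K \<phi> e - 3 / 7 * outcome_prob B K \<psi> e"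
    unfolding outcome_prob_def mat_app_diff by (rule norm_sq_diff_ge)
  moreover have "outcome_prob B K (\<lambda>v. \<phi> v - \<psi> v) e' \<ge> 3 / 10 * outcome_prob B K \<psi> e' - 3 / 7 * outcome_prob B K \<phi> e'"
    using norm_sq_diff_ge[of B "mat_app B (K e') \<psi>" "mat_app B (K e') \<phi>"]
    by (simp add: outcome_prob_def mat_app_diff norm_sq_def norm_minus_commute)
  ultimately show ?thesis
    using two[of \<phi>] two[of \<psi>] two[of "\<lambda>v. \<phi> v - \<psi> v"] assms(6-) by linarith
qed

lemma sign_strings_nonempty: "sign_strings S \<noteq> {}"
  by (simp add: sign_strings_def PiE_eq_empty_iff)

text \<open>The potential is \<open>D\<close>. Since \<open>w\<close> is symmetric and
  \<open>h\<close> is inverted when the strings are exchanged, what a pair charges to its second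
  string equals what the exchanged pair charges to its first, so bounds on rows suffice. A query
  adds at most \<open>4 * R\<close> per string, and at the end each string must carry
  \<open>W / 10\<close>; hence 40.\<close>

lemma weighted_adversary_lower_bound:
  fixes w :: "(nat \<Rightarrow> int) \<Rightarrow> (nat \<Rightarrow> int) \<Rightarrow> real"
  assumes \<Q>: "\<Q> \<subseteq> Pow {1..n}"
    and w_nonneg: "\<And>x y. w x y \<ge> 0" and w_sym: "\<And>x y. w x y = w y x"
    and h_pos: "\<And>q x y. h q x y > 0"
    and h_inv: "\<And>q x y. ans x q \<noteq> ans y q \<Longrightarrow> h q y x = 1 / h q x y"
    and row: "\<And>q x. q \<in> queries \<Q> \<Longrightarrow> x \<in> sign_strings {1..n} \<Longrightarrow>
      (\<Sum>y\<in>sign_strings {1..n}. if ans x q \<noteq> ans y q then w x y * h q x y else 0) \<le> R"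
    and total: "\<And>x. x \<in> sign_strings {1..n} \<Longrightarrow>
      W \<le> (\<Sum>y\<in>sign_strings {1..n}. if y \<noteq> x then w x y else 0)"
    and comp: "computes_in n \<Q> (sign_strings {1..n}) (\<lambda>x. x) T"
  shows "W \<le> 40 * R * real T"
proof -
  obtain d \<psi>\<^sub>0 U K where init: "norm_sq (basis_states \<Q> d) \<psi>\<^sub>0 = 1"
    and U: "\<And>t. t \<le> T \<Longrightarrow> unitary (basis_states \<Q> d) (U t)"
    and K: "measurement (basis_states \<Q> d) (sign_strings {1..n}) K"
    and correct: "\<And>x. x \<in> sign_strings {1..n} \<Longrightarrow>
      outcome_prob (basis_states \<Q> d) K (run (basis_states \<Q> d) U \<psi>\<^sub>0 x T) x \<ge> 2 / 3"
    using comp unfolding computes_in_def by blast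
  define B where "B = basis_states \<Q> d"
  define X where "X = sign_strings {1..n}"
  define \<psi> where "\<psi> x t = run B U \<psi>\<^sub>0 x t" for x t
  define D where "D t = (\<Sum>x\<in>X. \<Sum>y\<in>X. w x y * norm_sq B (\<lambda>v. \<psi> x t v - \<psi> y t v))" for t
  have B: "finite B" by (simp add: B_def finite_basis_states[OF \<Q>])
  have X: "finite X" "X \<noteq> {}" by (simp_all add: X_def finite_sign_strings sign_strings_nonempty)
  have norm: "norm_sq B (\<psi> x t) = 1" if "t \<le> T" for x t
    unfolding \<psi>_def B_def using that by (intro norm_sq_run[OF \<Q> init U])
  have step: "D (Suc t) \<le> D t + 4 * R * card X" if t: "Suc t \<le> T" for t
  proof -
    define c where "c x q = query_weight d (\<psi> x t) q" for x q
    \<comment> \<open>The share charged to the amplitude of \<open>x\<close> on the query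
      \<open>q\<close>; the share charged to \<open>y\<close> is \<open>f y x q\<close>.\<close>
    define f where "f x y q = (if ans x q \<noteq> ans y q then w x y * h q x y * c x q else 0)" for x y q
    have "norm_sq B (\<lambda>v. \<psi> x (Suc t) v - \<psi> y (Suc t) v) \<le> norm_sq B (\<lambda>v. \<psi> x t v - \<psi> y t v) +
        (\<Sum>q\<in>queries \<Q>. if ans x q \<noteq> ans y q then 2 * (h q x y * c x q + c y q / h q x y) else 0)" for x y
    proof -
      have "norm_sq B (\<lambda>v. \<psi> x (Suc t) v - \<psi> y (Suc t) v) =
          norm_sq B (\<lambda>v. mat_app B (query_op x) (\<psi> x t) v - mat_app B (query_op y) (\<psi> y t) v)"
        using U[OF t] B by (simp add: \<psi>_def unitary_norm_sq B_def flip: mat_app_diff)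
      also have "\<dots> \<le> norm_sq B (\<lambda>v. \<psi> x t v - \<psi> y t v) +
        (\<Sum>q\<in>queries \<Q>. if ans x q \<noteq> ans y q then 2 * (h q x y * c x q + c y q / h q x y) else 0)"
        unfolding B_def c_def by (intro query_op_distance[OF \<Q>] h_pos)
      finally show ?thesis .
    qed
    hence "D (Suc t) \<le> (\<Sum>x\<in>X. \<Sum>y\<in>X. w x y * (norm_sq B (\<lambda>v. \<psi> x t v - \<psi> y t v) +
        (\<Sum>q\<in>queries \<Q>. if ans x q \<noteq> ans y q then 2 * (h q x y * c x q + c y q / h q x y) else 0)))"
      unfolding D_def by (intro sum_mono mult_left_mono w_nonneg)
    also have "\<dots> = D t + (\<Sum>x\<in>X. \<Sum>y\<in>X. \<Sum>q\<in>queries \<Q>. 2 * f x y q + 2 * f y x q)"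
    proof -
      have "w x y * (if ans x q \<noteq> ans y q then 2 * (h q x y * c x q + c y q / h q x y) else 0) =
          2 * f x y q + 2 * f y x q" for x y q
      proof (cases "ans x q = ans y q")
        case False
        show ?thesis
          using False unfolding f_def h_inv[OF False] w_sym[of y x] by (simp add: algebra_simps)
      qed (simp add: f_def)
      thus ?thesis
        by (simp only: D_def sum.distrib[symmetric] distrib_left sum_distrib_left)
    qed
    also have "(\<Sum>x\<in>X. \<Sum>y\<in>X. \<Sum>q\<in>queries \<Q>. 2 * f x y q + 2 * f y x q) =
        4 * (\<Sum>x\<in>X. \<Sum>y\<in>X. \<Sum>q\<in>queries \<Q>. f x y q)"
      using sum.swap[of "\<lambda>x y. \<Sum>q\<in>queries \<Q>. f x y q" X X]
      by (simp add: sum.distrib flip: sum_distrib_left)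
    also have "(\<Sum>x\<in>X. \<Sum>y\<in>X. \<Sum>q\<in>queries \<Q>. f x y q) = (\<Sum>x\<in>X. \<Sum>q\<in>queries \<Q>. \<Sum>y\<in>X. f x y q)"
      by (intro sum.cong refl sum.swap)
    also have "\<dots> = (\<Sum>x\<in>X. \<Sum>q\<in>queries \<Q>.
        (\<Sum>y\<in>X. if ans x q \<noteq> ans y q then w x y * h q x y else 0) * c x q)"
      unfolding sum_distrib_right f_def by (intro sum.cong refl) auto
    also have "\<dots> \<le> (\<Sum>x\<in>X. \<Sum>q\<in>queries \<Q>. R * c x q)"
      using row by (intro sum_mono mult_right_mono) (auto simp: X_def c_def query_weight_nonneg)
    also have "\<dots> = R * card X"
      using norm[of t] t by (simp add: c_def flip: sum_distrib_left norm_sq_basis_states B_def)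
    finally show ?thesis by simp
  qed
  have "D t \<le> 4 * R * card X * real t" if "t \<le> T" for t
    using that
  proof (induction t)
    case 0
    show ?case by (simp add: D_def \<psi>_def norm_sq_def)
  next
    case (Suc t)
    show ?case using step[of t] Suc by (simp add: algebra_simps)
  qed
  moreover have "D T \<ge> (\<Sum>x\<in>X. W * (1 / 10))"
    unfolding D_def
  proof (intro sum_mono)
    fix x assume x: "x \<in> X"
    have "norm_sq B (\<lambda>v. \<psi> x T v - \<psi> y T v) \<ge> 1 / 10" if "y \<in> X" "x \<noteq> y" for y
      by (rule distinguishable_distance[OF B, of X K x y])
         (use that x K correct norm[of T] in \<open>auto simp: X_def B_def \<psi>_def\<close>)
    hence "(\<Sum>y\<in>X. if y \<noteq> x then w x y * (1 / 10) else 0) \<le>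
        (\<Sum>y\<in>X. w x y * norm_sq B (\<lambda>v. \<psi> x T v - \<psi> y T v))"
      by (intro sum_mono) (auto intro!: mult_left_mono mult_nonneg_nonneg w_nonneg norm_sq_nonneg simp del: times_divide_eq_right)
    moreover have "W * (1 / 10) \<le> (\<Sum>y\<in>X. if y \<noteq> x then w x y else 0) * (1 / 10)"
      using total[of x] x by (intro mult_right_mono) (auto simp: X_def)
    ultimately show "W * (1 / 10) \<le> (\<Sum>y\<in>X. w x y * norm_sq B (\<lambda>v. \<psi> x T v - \<psi> y T v))"
      by (simp only: sum_distrib_right if_distrib[of "\<lambda>r. r * (1/10)"] mult_zero_left)
  qed
  ultimately have "card X * (W * (1 / 10)) \<le> card X * (4 * R * real T)"
    by (fastforce simp: mult_ac)
  hence "W * (1 / 10) \<le> 4 * R * real T"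
    using X by (subst (asm) mult_le_cancel_left_pos) (auto simp: card_gt_0_iff)
  thus ?thesis by simp
qed

section \<open>Algorithms from dual adversary witnesses\<close>

text \<open>
  Labels \<open>k\<close> of the workspace: \<open>Inl None\<close> is the idle state, \<open>Inl (Some y)\<close> the final state for output \<open>y\<close>,
  and \<open>Inr l\<close> carries the witness.  The first two put the answer bit into a uniform superposition,
  so that queries do not act on them.
\<close>

definition dual_amp ::
    "(nat set \<times> (nat \<Rightarrow> int)) \<Rightarrow> ((nat \<Rightarrow> int) \<Rightarrow> (nat set \<times> (nat \<Rightarrow> int)) \<Rightarrow> 'l \<Rightarrow> real) \<Rightarrow> real \<Rightarrow> real \<Rightarrow> real
      \<Rightarrow> ((nat set \<times> (nat \<Rightarrow> int)) \<Rightarrow> nat) \<Rightarrow> (nat \<Rightarrow> int) \<Rightarrow> (nat set \<times> (nat \<Rightarrow> int)) \<Rightarrow> nat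
      \<Rightarrow> (nat \<Rightarrow> int) option + 'l \<Rightarrow> real" where
  "dual_amp q\<^sub>0 u s c r A x q a k = (case k of
       Inl None \<Rightarrow> if q = q\<^sub>0 then c / sqrt 2 else 0
     | Inl (Some y) \<Rightarrow> if q = q\<^sub>0 \<and> y = x then s / sqrt 2 else 0
     | Inr l \<Rightarrow> if a = A q then r * u x q l else 0)"

definition dual_state where
  "dual_state g q\<^sub>0 u s c r A x = (\<lambda>(q, a, w). complex_of_real (dual_amp q\<^sub>0 u s c r A x q a (g w)))"

text \<open>\<open>A q\<close> is the answer bit at which the witness sits on query
  \<open>q\<close>: constantly 0 before a query, \<open>ans x\<close> after it. Parts at different
  bits are orthogonal, so a query removes exactly the overlap on queries that separate
  \<open>x\<close> from \<open>y\<close>. The two halves \<open>1 / sqrt 2\<close> of the idle and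
  final parts restore the full amplitudes \<open>c\<close> and \<open>s\<close>.\<close>

lemma inner_prod_dual_state:
  fixes d :: nat
  assumes \<Q>: "\<Q> \<subseteq> Pow {1..n}" and q\<^sub>0: "q\<^sub>0 \<in> queries \<Q>" and X: "finite X" "x \<in> X" and W: "finite W"
    and g: "bij_betw g {..<d} (insert None (Some ` X) <+> W)"
    and A: "\<And>q. A q \<in> {0, 1}" and A': "\<And>q. A' q \<in> {0, 1}"
  shows "inner_prod (basis_states \<Q> d) (dual_state g q\<^sub>0 u s c r A x) (dual_state g q\<^sub>0 u s' c' r' A' y) =
    of_real ((if x = y then s * s' else 0) + c * c' +
      r * r' * (\<Sum>q\<in>queries \<Q>. if A q = A' q then \<Sum>l\<in>W. u x q l * u y q l else 0))"
proof -
  define G where "G q k = dual_amp q\<^sub>0 u s c r A x q 0 k * dual_amp q\<^sub>0 u s' c' r' A' y q 0 k +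
      dual_amp q\<^sub>0 u s c r A x q 1 k * dual_amp q\<^sub>0 u s' c' r' A' y q 1 k" for q k
  have GN: "G q (Inl None) = (if q = q\<^sub>0 then c * c' else 0)" for q
    by (simp add: G_def dual_amp_def)
  have GS: "G q (Inl (Some z)) = (if z = x then if q = q\<^sub>0 \<and> x = y then s * s' else 0 else 0)" for q z
    by (simp add: G_def dual_amp_def)
  have GR: "G q (Inr l) = (if A q = A' q then r * r' * (u x q l * u y q l) else 0)" for q l
    using A[of q] A'[of q] by (auto simp: G_def dual_amp_def)
  have "inner_prod (basis_states \<Q> d) (dual_state g q\<^sub>0 u s c r A x) (dual_state g q\<^sub>0 u s' c' r' A' y) =
      of_real (\<Sum>q\<in>queries \<Q>. \<Sum>w<d. G q (g w))"
    by (simp add: inner_prod_def sum_basis_states dual_state_def G_def)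
  also have "(\<Sum>q\<in>queries \<Q>. \<Sum>w<d. G q (g w)) =
      (\<Sum>q\<in>queries \<Q>. \<Sum>k\<in>insert None (Some ` X) <+> W. G q k)"
    by (intro sum.cong refl sum.reindex_bij_betw g)
  also have "\<dots> = (\<Sum>q\<in>queries \<Q>. (if q = q\<^sub>0 then c * c' else 0) + (if q = q\<^sub>0 \<and> x = y then s * s' else 0)
      + (\<Sum>l\<in>W. if A q = A' q then r * r' * (u x q l * u y q l) else 0))"
    using X W by (simp add: sum.Plus sum.reindex GN GS GR)
  also have "\<dots> = c * c' + (if x = y then s * s' else 0) +
      (\<Sum>q\<in>queries \<Q>. \<Sum>l\<in>W. if A q = A' q then r * r' * (u x q l * u y q l) else 0)"
    using q\<^sub>0 finite_queries[OF \<Q>] by (simp add: sum.distrib)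
  also have "(\<Sum>q\<in>queries \<Q>. \<Sum>l\<in>W. if A q = A' q then r * r' * (u x q l * u y q l) else 0) =
      r * r' * (\<Sum>q\<in>queries \<Q>. if A q = A' q then \<Sum>l\<in>W. u x q l * u y q l else 0)"
    unfolding sum_distrib_left by (intro sum.cong refl) (simp add: sum_distrib_left)
  finally show ?thesis by (simp add: add.commute)
qed

lemma query_op_dual_state:
  fixes d :: nat
  assumes \<Q>: "\<Q> \<subseteq> Pow {1..n}" and v: "v \<in> basis_states \<Q> d"
  shows "mat_app (basis_states \<Q> d) (query_op x) (dual_state g q\<^sub>0 u s c r (\<lambda>_. 0) x) v =
    dual_state g q\<^sub>0 u s c r (ans x) x v"
proof -
  obtain q a w where v': "v = (q, a, w)" "q \<in> queries \<Q>" "a \<in> {0, 1}" "w < d"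
    using v unfolding basis_states_def by blast
  have iff: "(a + ans x q) mod 2 = 0 \<longleftrightarrow> a = ans x q"
    using v'(3) ans_le_1[of x q] by (elim insertE disjE emptyE) simp_all
  show ?thesis
    unfolding v'(1) mat_app_query_op[OF \<Q> v'(2-4)] dual_state_def dual_amp_def prod.case iff ..
qed

text \<open>
  If the vector with entries \<open>u x q l\<close>, placed at answer bit 0, were available for free, one query
  would map the Gram matrix \<open>\<langle>v\<^sub>x,v\<^sub>y\<rangle> + 1\<close> to \<open>\<langle>v\<^sub>x,v\<^sub>y\<rangle> + \<delta>\<^sub>x\<^sub>y\<close>.  The algorithm instead moves the weight
  \<open>1 / T\<close> per query from the idle state to an orthonormal family, using the catalyst \<open>v\<^sub>x\<close> scaled by
  \<open>1 / sqrt T\<close>.  Since the scaled catalyst is short, it may be left out of the initial state.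
\<close>

lemma dual_adversary_upper_bound:
  assumes \<Q>: "\<Q> \<subseteq> Pow {1..n}" "\<Q> \<noteq> {}" and W: "finite W"
    and sep: "\<And>x y. x \<in> sign_strings {1..n} \<Longrightarrow> y \<in> sign_strings {1..n} \<Longrightarrow> x \<noteq> y \<Longrightarrow>
      (\<Sum>q\<in>queries \<Q>. if ans x q \<noteq> ans y q then \<Sum>l\<in>W. u x q l * u y q l else 0) = 1"
    and cost: "\<And>x. x \<in> sign_strings {1..n} \<Longrightarrow> (\<Sum>q\<in>queries \<Q>. \<Sum>l\<in>W. (u x q l)\<^sup>2) \<le> L"
    and T: "36 * L \<le> real T" "T > 0"
  shows "computes_in n \<Q> (sign_strings {1..n}) (\<lambda>x. x) T"
proof -
  define X where "X = sign_strings {1..n}"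
  have X: "finite X" by (simp add: X_def finite_sign_strings)
  \<comment> \<open>A default output for labels that name no string. It also fills the string
    argument of the initial state, whose final and witness amplitudes are 0, so that this state does
    not depend on the input.\<close>
  obtain x\<^sub>0 where x\<^sub>0: "x\<^sub>0 \<in> X" using sign_strings_nonempty by (auto simp: X_def)
  obtain q\<^sub>0 where q\<^sub>0: "q\<^sub>0 \<in> queries \<Q>"
    using \<Q>(2) sign_strings_nonempty by (metis SigmaI all_not_in_conv)
  define M where "M = insert None (Some ` X) <+> W"
  define d where "d = card M"
  have "finite M" using X W by (simp add: M_def)
  then obtain g where g: "bij_betw g {..<d} M"
    using ex_bij_betw_nat_finite[of M] by (auto simp: d_def atLeast0LessThan)
  define B where "B = basis_states \<Q> d"
  have B: "finite B" by (simp add: B_def finite_basis_states[OF \<Q>(1)])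
  note ip = inner_prod_dual_state[OF \<Q>(1) q\<^sub>0 X _ W g[unfolded M_def], folded B_def]
  \<comment> \<open>\<open>\<Phi> t\<close> is the ideal state after \<open>t\<close> queries and
    the unitary that follows them; \<open>\<Psi> t\<close> is the same state after one further
    query.\<close>
  define \<Phi> where "\<Phi> t x = dual_state g q\<^sub>0 u (sqrt (t / T)) (sqrt (1 - t / T)) (1 / sqrt T) (\<lambda>_. 0) x" for t :: nat and x
  define \<Psi> where "\<Psi> t x = dual_state g q\<^sub>0 u (sqrt (t / T)) (sqrt (1 - t / T)) (1 / sqrt T) (ans x) x" for t :: nat and x
  define \<psi>\<^sub>0 where "\<psi>\<^sub>0 = dual_state g q\<^sub>0 u 0 1 0 (\<lambda>_. 0) x\<^sub>0"
  have ans01: "ans x q \<in> {0, 1}" for x q using ans_le_1[of x q] by blast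
  have sq: "sqrt (real t / T) * sqrt (real t / T) = t / T" "sqrt (1 - real t / T) * sqrt (1 - real t / T) = 1 - t / T"
    if "t \<le> T" for t
    using that T(2) by (auto simp: divide_le_eq)
  have sqT: "1 / sqrt (real T) * (1 / sqrt (real T)) = 1 / T" by simp
  \<comment> \<open>For distinct strings the query removes overlap \<open>1 / T\<close> by
    separation. Moving weight \<open>1 / T\<close> from the idle part, common to all strings, to the
    orthogonal final parts removes the same amount. For equal strings neither changes
    anything.\<close>
  have gram: "inner_prod B (\<Psi> t x) (\<Psi> t y) = inner_prod B (\<Phi> (Suc t) x) (\<Phi> (Suc t) y)"
    if t: "t < T" and xy: "x \<in> X" "y \<in> X" for t x y
  proof -
    define f where "f q = (\<Sum>l\<in>W. u x q l * u y q l)" for q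
    have "(\<Sum>q\<in>queries \<Q>. f q) = (\<Sum>q\<in>queries \<Q>. if ans x q = ans y q then f q else 0) +
        (\<Sum>q\<in>queries \<Q>. if ans x q \<noteq> ans y q then f q else 0)"
      unfolding sum.distrib[symmetric] by (intro sum.cong) auto
    also have "(\<Sum>q\<in>queries \<Q>. if ans x q \<noteq> ans y q then f q else 0) = (if x = y then 0 else 1)"
      using sep[of x y] xy unfolding X_def f_def by (cases "x = y") simp_all
    finally have "(\<Sum>q\<in>queries \<Q>. f q) = (\<Sum>q\<in>queries \<Q>. if ans x q = ans y q then f q else 0) +
        (if x = y then 0 else 1)" .
    moreover have "inner_prod B (\<Psi> t x) (\<Psi> t y) = of_real ((if x = y then t / T else 0) + (1 - t / T) +
        1 / T * (\<Sum>q\<in>queries \<Q>. if ans x q = ans y q then f q else 0))"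
      using t unfolding \<Psi>_def f_def ip[OF xy(1) ans01 ans01] by (simp only: sq sqT less_imp_le)
    moreover have "inner_prod B (\<Phi> (Suc t) x) (\<Phi> (Suc t) y) = of_real ((if x = y then Suc t / T else 0) + (1 - Suc t / T) +
        1 / T * (\<Sum>q\<in>queries \<Q>. f q))"
      using t unfolding \<Phi>_def f_def ip[OF xy(1) insertI1 insertI1] by (simp only: sq sqT Suc_leI simp_thms if_True)
    ultimately show ?thesis
      by (simp only: of_real_eq_iff) (use T(2) in \<open>simp add: field_simps\<close>)
  qed
  have ex: "\<exists>U. unitary B U \<and> (\<forall>x\<in>X. \<forall>v\<in>B. mat_app B U (\<Psi> t x) v = \<Phi> (Suc t) x v)" if "t < T" for t
    by (rule equal_gram_unitary[OF B X gram[OF that]])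
  define V where "V t = (SOME U. unitary B U \<and> (\<forall>x\<in>X. \<forall>v\<in>B. mat_app B U (\<Psi> t x) v = \<Phi> (Suc t) x v))" for t
  have V: "unitary B (V t)" and V\<Psi>: "\<And>x v. x \<in> X \<Longrightarrow> v \<in> B \<Longrightarrow> mat_app B (V t) (\<Psi> t x) v = \<Phi> (Suc t) x v"
    if "t < T" for t
    using someI_ex[OF ex[OF that]] unfolding V_def[of t] by simp_all
  define U where "U t = (case t of 0 \<Rightarrow> (\<lambda>v u. if v = u then 1 else 0) | Suc t \<Rightarrow> V t)" for t
  have U: "unitary B (U t)" if "t \<le> T" for t
    using that V unitary_id[OF B] by (auto simp: U_def split: nat.split)
  have query: "mat_app B (query_op x) (\<Phi> t x) v = \<Psi> t x v" if "v \<in> B" for t x v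
    using that query_op_dual_state[OF \<Q>(1)] by (simp add: B_def \<Phi>_def \<Psi>_def)
  \<comment> \<open>Queries and unitaries preserve distances, so the only error is the omitted
    catalyst, of squared norm at most \<open>L / T\<close>.\<close>
  have close: "norm_sq B (\<lambda>v. run B U \<psi>\<^sub>0 x t v - \<Phi> t x v) \<le> 1 / 36" if x: "x \<in> X" and "t \<le> T" for x t
    using that(2)
  proof (induction t)
    case 0
    have "run B U \<psi>\<^sub>0 x 0 v - \<Phi> 0 x v = dual_state g q\<^sub>0 u 0 0 (- 1 / sqrt T) (\<lambda>_. 0) x v" if v: "v \<in> B" for v
    proof -
      have "run B U \<psi>\<^sub>0 x 0 v = (\<Sum>u\<in>B. if v = u then \<psi>\<^sub>0 u else 0)"
        using v by (auto simp: mat_app_def U_def intro!: sum.cong)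
      hence "run B U \<psi>\<^sub>0 x 0 v = \<psi>\<^sub>0 v" using B v by simp
      thus ?thesis
        by (cases v) (auto simp: \<psi>\<^sub>0_def \<Phi>_def dual_state_def dual_amp_def split: sum.split option.split)
    qed
    hence "norm_sq B (\<lambda>v. run B U \<psi>\<^sub>0 x 0 v - \<Phi> 0 x v) =
        norm_sq B (dual_state g q\<^sub>0 u 0 0 (- 1 / sqrt T) (\<lambda>_. 0) x)"
      by (intro norm_sq_cong)
    also have "complex_of_real \<dots> = of_real (1 / T * (\<Sum>q\<in>queries \<Q>. \<Sum>l\<in>W. (u x q l)\<^sup>2))"
      using x T(2) ip[of x "\<lambda>_. 0" "\<lambda>_. 0" u 0 0 "- 1 / sqrt T" 0 0 "- 1 / sqrt T" x]
      by (simp add: norm_sq_inner_prod power2_eq_square)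
    hence "norm_sq B (dual_state g q\<^sub>0 u 0 0 (- 1 / sqrt T) (\<lambda>_. 0) x) =
        1 / T * (\<Sum>q\<in>queries \<Q>. \<Sum>l\<in>W. (u x q l)\<^sup>2)"
      by (simp only: of_real_eq_iff)
    also have "\<dots> \<le> 1 / T * L"
      using cost[of x] x T(2) by (intro mult_left_mono) (auto simp: X_def)
    also have "\<dots> \<le> 1 / 36" using T by (simp add: field_simps)
    finally show ?case .
  next
    case (Suc t)
    have "norm_sq B (\<lambda>v. run B U \<psi>\<^sub>0 x (Suc t) v - \<Phi> (Suc t) x v) =
        norm_sq B (\<lambda>v. mat_app B (V t) (mat_app B (query_op x) (run B U \<psi>\<^sub>0 x t)) v
          - mat_app B (V t) (mat_app B (query_op x) (\<Phi> t x)) v)"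
    proof (intro norm_sq_cong)
      fix v assume v: "v \<in> B"
      have "mat_app B (V t) (mat_app B (query_op x) (\<Phi> t x)) v = mat_app B (V t) (\<Psi> t x) v"
        using query by (simp add: mat_app_def)
      thus "run B U \<psi>\<^sub>0 x (Suc t) v - \<Phi> (Suc t) x v =
          mat_app B (V t) (mat_app B (query_op x) (run B U \<psi>\<^sub>0 x t)) v
          - mat_app B (V t) (mat_app B (query_op x) (\<Phi> t x)) v"
        using V\<Psi>[of t x v] Suc.prems x v by (simp add: U_def)
    qed
    also have "\<dots> = norm_sq B (\<lambda>v. run B U \<psi>\<^sub>0 x t v - \<Phi> t x v)"
      by (simp only: mat_app_diff[symmetric] unitary_norm_sq[OF B V[OF Suc_le_lessD[OF Suc.prems]]]
          norm_sq_query_op[OF \<Q>(1), of d, folded B_def])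
    finally show ?case using Suc by simp
  qed
  define outcome where "outcome w = (case g w of Inl (Some y) \<Rightarrow> if y \<in> X then y else x\<^sub>0 | _ \<Rightarrow> x\<^sub>0)" for w
  define K :: "(nat \<Rightarrow> int) \<Rightarrow> basis_state operator" where
    "K e v u = (if v = u \<and> outcome (snd (snd v)) = e then 1 else 0)" for e v u
  have outcome: "outcome w \<in> X" for w
    using x\<^sub>0 by (auto simp: outcome_def split: sum.split option.split)
  have K_app: "mat_app B (K e) \<psi> v = (if outcome (snd (snd v)) = e then \<psi> v else 0)" if "v \<in> B" for e \<psi> v
  proof -
    have "mat_app B (K e) \<psi> v = (\<Sum>u\<in>B. if v = u then if outcome (snd (snd v)) = e then \<psi> v else 0 else 0)"
      using that by (auto simp: mat_app_def K_def intro!: sum.cong)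
    thus ?thesis using B that by simp
  qed
  have K: "measurement B X K"
    unfolding measurement_def is_identity_def
  proof (intro conjI ballI X)
    fix v u assume vu: "v \<in> B" "u \<in> B"
    have "mat_mult B (adj (K e)) (K e) v u = (if outcome (snd (snd v)) = e then if v = u then 1 else 0 else 0)" for e
    proof -
      have "mat_mult B (adj (K e)) (K e) v u = (\<Sum>w\<in>B. if v = w then if v = u \<and> outcome (snd (snd v)) = e then 1 else 0 else 0)"
        unfolding mat_mult_def adj_def K_def by (intro sum.cong refl) auto
      thus ?thesis using B vu by simp
    qed
    thus "(\<Sum>e\<in>X. mat_mult B (adj (K e)) (K e) v u) = (if v = u then 1 else 0)"
      using X outcome by simp
  qed
  have correct: "outcome_prob B K (run B U \<psi>\<^sub>0 x T) x \<ge> 2 / 3" if x: "x \<in> X" for x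
  proof -
    have "Inl (Some x) \<in> M" using x by (auto simp: M_def)
    then obtain i where i: "i < d" "g i = Inl (Some x)"
      using g unfolding bij_betw_def by (metis imageE lessThan_iff)
    define R where "R = {(q\<^sub>0, 0::nat, i), (q\<^sub>0, 1, i)}"
    have RB: "R \<subseteq> B" using i q\<^sub>0 by (auto simp: R_def B_def basis_states_def)
    \<comment> \<open>Applied with \<open>a\<close> the ideal and \<open>p\<close> the actual
      amplitude: the ideal state has weight 1 on \<open>R\<close>, and 5/6 - 6/36 = 2/3. This is
      where the factor 36 in the number of queries originates.\<close>
    have ineq: "(cmod p)\<^sup>2 \<ge> 5 / 6 * (cmod a)\<^sup>2 - 6 * (cmod (p - a))\<^sup>2" for p a
    proof -
      have "cmod a \<le> cmod p + cmod (p - a)" by norm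
      hence "(cmod a)\<^sup>2 \<le> (cmod p + cmod (p - a))\<^sup>2" by (simp add: power_mono)
      also have "\<dots> = (cmod p)\<^sup>2 + (cmod (p - a))\<^sup>2 + 2 * (cmod p * cmod (p - a))"
        by (simp add: power2_sum)
      finally have "(cmod a)\<^sup>2 \<le> (cmod p)\<^sup>2 + (cmod (p - a))\<^sup>2 + 2 * (cmod p * cmod (p - a))" .
      moreover have "0 \<le> (cmod p - 5 * cmod (p - a))\<^sup>2" by simp
      hence "10 * (cmod p * cmod (p - a)) \<le> (cmod p)\<^sup>2 + 25 * (cmod (p - a))\<^sup>2"
        by (simp add: power2_diff power_mult_distrib mult_ac)
      moreover have "0 \<le> (cmod (p - a))\<^sup>2" by simp
      ultimately show ?thesis by linarith
    qed
    have "2 / 3 \<le> 5 / 6 * (\<Sum>v\<in>R. (cmod (\<Phi> T x v))\<^sup>2) - 6 * norm_sq B (\<lambda>v. run B U \<psi>\<^sub>0 x T v - \<Phi> T x v)"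
    proof -
      have "(\<Sum>v\<in>R. (cmod (\<Phi> T x v))\<^sup>2) = 1"
        using T(2) i by (simp add: R_def \<Phi>_def dual_state_def dual_amp_def norm_divide power_divide)
      thus ?thesis using close[OF x, of T] by simp
    qed
    also have "\<dots> \<le> 5 / 6 * (\<Sum>v\<in>R. (cmod (\<Phi> T x v))\<^sup>2) - 6 * (\<Sum>v\<in>R. (cmod (run B U \<psi>\<^sub>0 x T v - \<Phi> T x v))\<^sup>2)"
      unfolding norm_sq_def using RB B by (intro diff_left_mono mult_left_mono sum_mono2) auto
    also have "\<dots> \<le> (\<Sum>v\<in>R. (cmod (run B U \<psi>\<^sub>0 x T v))\<^sup>2)"
      unfolding sum_distrib_left sum_subtractf[symmetric] by (intro sum_mono ineq)
    also have "\<dots> = (\<Sum>v\<in>R. (cmod (mat_app B (K x) (run B U \<psi>\<^sub>0 x T) v))\<^sup>2)"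
      using RB K_app x i by (intro sum.cong refl) (auto simp: R_def outcome_def)
    also have "\<dots> \<le> outcome_prob B K (run B U \<psi>\<^sub>0 x T) x"
      unfolding outcome_prob_def norm_sq_def using RB B by (intro sum_mono2) auto
    finally show ?thesis .
  qed
  have "complex_of_real (norm_sq B \<psi>\<^sub>0) = of_real 1"
    using ip[OF x\<^sub>0, of "\<lambda>_. 0" "\<lambda>_. 0" u 0 1 0 0 1 0 x\<^sub>0] by (simp add: norm_sq_inner_prod \<psi>\<^sub>0_def)
  hence "norm_sq B \<psi>\<^sub>0 = 1" by (simp only: of_real_eq_iff)
  thus ?thesis
    unfolding computes_in_def using U K correct by (fold X_def, intro exI[of _ d]) (fold B_def, blast)
qed

lemma Q_rec_le: "computes_in n \<Q> (sign_strings {1..n}) (\<lambda>x. x) T \<Longrightarrow> Q_rec n \<Q> \<le> ereal (real T)"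
proof -
  assume "computes_in n \<Q> (sign_strings {1..n}) (\<lambda>x. x) T"
  hence "quantum_query_complexity n \<Q> (sign_strings {1..n}) (\<lambda>x. x) \<le> enat T"
    unfolding quantum_query_complexity_def by (intro Inf_lower imageI CollectI)
  hence "Q_rec n \<Q> \<le> ereal_of_enat (enat T)"
    unfolding Q_rec_def ereal_of_enat_le_iff .
  thus ?thesis by simp
qed

lemma restrict_eq_iff: "restrict x S = restrict y S \<longleftrightarrow> (\<forall>i\<in>S. x i = y i)"
  by (auto simp: restrict_def fun_eq_iff)

lemma sequential_upper_bound:
  fixes \<gamma> :: "nat \<Rightarrow> (nat \<Rightarrow> int) \<Rightarrow> nat set \<times> (nat \<Rightarrow> int) \<Rightarrow> real"
  assumes \<Q>: "\<Q> \<subseteq> Pow {1..n}" "\<Q> \<noteq> {}" and n: "n \<le> m * k"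
    and sep: "\<And>j x y. j < m \<Longrightarrow> x \<in> sign_strings {1..n} \<Longrightarrow> y \<in> sign_strings {1..n} \<Longrightarrow>
      \<forall>i\<in>{1..j * k}. x i = y i \<Longrightarrow>
      (\<Sum>q\<in>queries \<Q>. if ans x q \<noteq> ans y q then \<gamma> j x q * \<gamma> j y q else 0) =
      (if \<forall>i\<in>{1..Suc j * k}. x i = y i then 0 else 1)"
    and cost: "\<And>j x. j < m \<Longrightarrow> x \<in> sign_strings {1..n} \<Longrightarrow> (\<Sum>q\<in>queries \<Q>. (\<gamma> j x q)\<^sup>2) \<le> L"
    and L: "real m * L \<le> Y" "1 \<le> Y"
  shows "Q_rec n \<Q> \<le> ereal (37 * Y)"
proof -
  define X where "X = sign_strings {1..n}"
  have X: "finite X" by (simp add: X_def finite_sign_strings)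
  define P where "P j x = restrict x {1..j * k}" for j and x :: "nat \<Rightarrow> int"
  define W where "W = (SIGMA j:{..<m}. P j ` X)"
  define u where "u x q = (\<lambda>(j, l). if l = P j x then \<gamma> j x q else 0)" for x q
  have P_iff: "P j x = P j y \<longleftrightarrow> (\<forall>i\<in>{1..j * k}. x i = y i)" for j x y
    unfolding P_def by (rule restrict_eq_iff)
  have W: "finite W" using X by (simp add: W_def)
  have inner: "(\<Sum>l\<in>W. u x q l * u y q l) = (\<Sum>j<m. if P j x = P j y then \<gamma> j x q * \<gamma> j y q else 0)"
    if "x \<in> X" for x y q
  proof -
    have "(\<Sum>l\<in>W. u x q l * u y q l) = (\<Sum>j<m. \<Sum>l\<in>P j ` X. u x q (j, l) * u y q (j, l))"
      unfolding W_def using X by (subst sum.Sigma) (auto simp: case_prod_unfold)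
    also have "\<dots> = (\<Sum>j<m. \<Sum>l\<in>P j ` X. if l = P j x then if P j x = P j y then \<gamma> j x q * \<gamma> j y q else 0 else 0)"
      by (intro sum.cong refl) (auto simp: u_def)
    also have "\<dots> = (\<Sum>j<m. if P j x = P j y then \<gamma> j x q * \<gamma> j y q else 0)"
      using X that by (intro sum.cong refl) (simp add: sum.delta)
    finally show ?thesis .
  qed
  \<comment> \<open>Rounding \<open>36 * Y\<close> up adds less than 1, which
    \<open>1 \<le> Y\<close> absorbs into the factor 37.\<close>
  define T where "T = nat \<lceil>36 * Y\<rceil>"
  have T: "36 * Y \<le> real T" "real T \<le> 37 * Y" "T > 0"
    using L(2) unfolding T_def by linarith+
  have "computes_in n \<Q> (sign_strings {1..n}) (\<lambda>x. x) T"
  proof (rule dual_adversary_upper_bound[OF \<Q> W, of u "real m * L"])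
    fix x y assume xy: "x \<in> sign_strings {1..n}" "y \<in> sign_strings {1..n}" "x \<noteq> y"
    define e where "e j = (if P j x = P j y then 1 else 0 :: real)" for j
    have "(\<Sum>q\<in>queries \<Q>. if ans x q \<noteq> ans y q then \<Sum>l\<in>W. u x q l * u y q l else 0) =
        (\<Sum>q\<in>queries \<Q>. \<Sum>j<m. if P j x = P j y then if ans x q \<noteq> ans y q then \<gamma> j x q * \<gamma> j y q else 0 else 0)"
      unfolding inner[OF xy(1)[folded X_def]]
    proof (intro sum.cong refl)
      fix q
      show "(if ans x q \<noteq> ans y q then \<Sum>j<m. if P j x = P j y then \<gamma> j x q * \<gamma> j y q else 0 else 0) =
          (\<Sum>j<m. if P j x = P j y then if ans x q \<noteq> ans y q then \<gamma> j x q * \<gamma> j y q else 0 else 0)"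
        by (cases "ans x q = ans y q") (simp_all cong: if_cong)
    qed
    also have "\<dots> = (\<Sum>j<m. \<Sum>q\<in>queries \<Q>. if P j x = P j y then if ans x q \<noteq> ans y q then \<gamma> j x q * \<gamma> j y q else 0 else 0)"
      by (rule sum.swap)
    \<comment> \<open>\<open>e j\<close> indicates agreement on the first \<open>j\<close> blocks,
      so only the stage at the first disagreement contributes, and the sum telescopes.\<close>
    also have "\<dots> = (\<Sum>j<m. e j - e (Suc j))"
    proof (intro sum.cong refl)
      fix j assume j: "j \<in> {..<m}"
      show "(\<Sum>q\<in>queries \<Q>. if P j x = P j y then if ans x q \<noteq> ans y q then \<gamma> j x q * \<gamma> j y q else 0 else 0) =
          e j - e (Suc j)"
      proof (cases "P j x = P j y")
        case True
        have "(\<Sum>q\<in>queries \<Q>. if ans x q \<noteq> ans y q then \<gamma> j x q * \<gamma> j y q else 0) = 1 - e (Suc j)"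
          using sep[of j x y] j xy True by (simp add: e_def P_iff del: mult_Suc)
        thus ?thesis using True by (simp add: e_def)
      next
        case False
        hence "P (Suc j) x \<noteq> P (Suc j) y" by (auto simp: P_iff)
        thus ?thesis using False by (simp add: e_def)
      qed
    qed
    also have "\<dots> = e 0 - e m" by (rule sum_lessThan_telescope')
    also have "\<dots> = 1"
    proof -
      have "P m x \<noteq> P m y"
      proof
        assume "P m x = P m y"
        hence "x i = y i" if "i \<in> {1..n}" for i using that n by (auto simp: P_iff)
        hence "x = y" using xy by (intro PiE_ext[of x "{1..n}" "\<lambda>_. {-1, 1}" y]) (auto simp: sign_strings_def)
        thus False using xy by simp
      qed
      moreover have "P 0 x = P 0 y" by (simp add: P_iff)
      ultimately show ?thesis by (simp add: e_def)
    qed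
    finally show "(\<Sum>q\<in>queries \<Q>. if ans x q \<noteq> ans y q then \<Sum>l\<in>W. u x q l * u y q l else 0) = 1" .
  next
    fix x assume x: "x \<in> sign_strings {1..n}"
    have "(\<Sum>q\<in>queries \<Q>. \<Sum>l\<in>W. (u x q l)\<^sup>2) = (\<Sum>q\<in>queries \<Q>. \<Sum>j<m. (\<gamma> j x q)\<^sup>2)"
      using inner[of x _ x] x by (simp add: X_def power2_eq_square)
    also have "\<dots> = (\<Sum>j<m. \<Sum>q\<in>queries \<Q>. (\<gamma> j x q)\<^sup>2)" by (rule sum.swap)
    also have "\<dots> \<le> (\<Sum>j<m. L)" using cost x by (intro sum_mono) auto
    finally show "(\<Sum>q\<in>queries \<Q>. \<Sum>l\<in>W. (u x q l)\<^sup>2) \<le> real m * L" by simp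
  qed (use T L in auto)
  hence "Q_rec n \<Q> \<le> ereal (real T)" by (rule Q_rec_le)
  also have "\<dots> \<le> ereal (37 * Y)" using T by simp
  finally show ?thesis .
qed

section \<open>Witnesses for reconstruction\<close>

lemma restrict_sign_strings: "x \<in> sign_strings V \<Longrightarrow> S \<subseteq> V \<Longrightarrow> restrict x S \<in> sign_strings S"
  by (auto simp: sign_strings_def PiE_iff)

lemma sum_queries:
  assumes "\<Q> \<subseteq> Pow {1..n}"
  shows "(\<Sum>q\<in>queries \<Q>. f q) = (\<Sum>S\<in>\<Q>. \<Sum>b\<in>sign_strings S. f (S, b))"
proof -
  have "finite \<Q>" using assms by (rule finite_subset) simp
  moreover have "\<forall>S\<in>\<Q>. finite (sign_strings S)"
    using assms by (auto intro!: finite_sign_strings intro: finite_subset)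
  ultimately show ?thesis by (simp add: sum.Sigma)
qed

text \<open>For a fixed \<open>S\<close>, the guesses \<open>b\<close> that separate
  \<open>x\<close> from \<open>y\<close> are exactly their two restrictions, provided these
  differ.\<close>

lemma sum_queries_differ:
  assumes \<Q>: "\<Q> \<subseteq> Pow {1..n}" and x: "x \<in> sign_strings {1..n}" and y: "y \<in> sign_strings {1..n}"
  shows "(\<Sum>q\<in>queries \<Q>. if ans x q \<noteq> ans y q then f q else 0) =
    (\<Sum>S\<in>\<Q>. if \<forall>i\<in>S. x i = y i then 0 else f (S, restrict x S) + f (S, restrict y S))"
  unfolding sum_queries[OF \<Q>]
proof (intro sum.cong refl)
  fix S assume "S \<in> \<Q>"
  hence S: "S \<subseteq> {1..n}" using \<Q> by auto
  have fin: "finite (sign_strings S)" using S by (auto intro!: finite_sign_strings intro: finite_subset)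
  show "(\<Sum>b\<in>sign_strings S. if ans x (S, b) \<noteq> ans y (S, b) then f (S, b) else 0) =
      (if \<forall>i\<in>S. x i = y i then 0 else f (S, restrict x S) + f (S, restrict y S))"
  proof (cases "restrict x S = restrict y S")
    case True
    thus ?thesis by (simp add: answer_def flip: restrict_eq_iff)
  next
    case False
    have "(\<Sum>b\<in>sign_strings S. if ans x (S, b) \<noteq> ans y (S, b) then f (S, b) else 0) =
        (\<Sum>b\<in>sign_strings S. (if b = restrict x S then f (S, b) else 0) + (if b = restrict y S then f (S, b) else 0))"
      using False by (intro sum.cong refl) (auto simp: answer_def)
    also have "\<dots> = f (S, restrict x S) + f (S, restrict y S)"
      using fin restrict_sign_strings[OF x S] restrict_sign_strings[OF y S] by (simp add: sum.distrib)
    finally show ?thesis using False by (simp only: restrict_eq_iff if_False)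
  qed
qed

section \<open>Witnesses for the full set and for prefixes\<close>

lemma card_sign_strings: "finite S \<Longrightarrow> card (sign_strings S) = 2 ^ card S"
  by (simp add: sign_strings_def card_PiE numeral_2_eq_2)

text \<open>The witness behind Grover search. Two guesses separate a pair, and each contributes one
  large entry times one small entry, that is 1/2. The cost is N/2 for the true string plus 2^n /
  (2N) for all others, balanced at N = 2^(n/2).\<close>

lemma full_set_upper_bound:
  assumes n: "1 \<le> n"
  shows "Q_rec n {{1..n}} \<le> ereal (37 * 2 powr (real n / 2))"
proof -
  define N :: real where "N = 2 powr (real n / 2)"
  have N1: "N \<ge> 1" unfolding N_def by (rule ge_one_powr_ge_zero) auto
  have NN: "N * N = 2 ^ n" by (simp add: N_def powr_add[symmetric] powr_realpow)
  define \<gamma> :: "nat \<Rightarrow> (nat \<Rightarrow> int) \<Rightarrow> nat set \<times> (nat \<Rightarrow> int) \<Rightarrow> real" where "\<gamma> = (\<lambda>(j::nat) x (S, b). if restrict x S = b then sqrt (N / 2) else 1 / sqrt (2 * N))"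
  have prod: "sqrt (N / 2) * (1 / sqrt (2 * N)) = 1 / 2"
    using N1 by (simp add: real_sqrt_divide real_sqrt_mult)
  show ?thesis
    unfolding N_def[symmetric]
  proof (rule sequential_upper_bound[where m = 1 and k = n and \<gamma> = \<gamma> and L = N])
    fix j :: nat and x y assume xy: "x \<in> sign_strings {1..n}" "y \<in> sign_strings {1..n}" and j: "j < 1"
    show "(\<Sum>q\<in>queries {{1..n}}. if ans x q \<noteq> ans y q then \<gamma> j x q * \<gamma> j y q else 0) =
      (if \<forall>i\<in>{1..Suc j * n}. x i = y i then 0 else 1)"
      using j prod by (subst sum_queries_differ[OF _ xy]) (auto simp: \<gamma>_def restrict_eq_iff mult.commute)
  next
    fix j :: nat and x assume x: "x \<in> sign_strings {1..n}"
    have "(\<Sum>q\<in>queries {{1..n}}. (\<gamma> j x q)\<^sup>2) = (\<Sum>b\<in>sign_strings {1..n}. (\<gamma> j x ({1..n}, b))\<^sup>2)"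
      by (subst sum_queries) auto
    also have "\<dots> \<le> (\<Sum>b\<in>sign_strings {1..n}. (if restrict x {1..n} = b then N / 2 else 0) + 1 / (2 * N))"
      using N1 by (intro sum_mono) (auto simp: \<gamma>_def power_divide)
    also have "\<dots> = N / 2 + 2 ^ n / (2 * N)"
      using restrict_sign_strings[OF x, of "{1..n}"]
      by (simp add: sum.distrib finite_sign_strings card_sign_strings)
    also have "\<dots> = N" using N1 by (simp add: NN[symmetric])
    finally show "(\<Sum>q\<in>queries {{1..n}}. (\<gamma> j x q)\<^sup>2) \<le> N" .
  qed (use N1 in auto)
qed

lemma sum_queries_single:
  assumes "\<Q> \<subseteq> Pow {1..n}" "S \<in> \<Q>" "\<And>S' b. S' \<noteq> S \<Longrightarrow> f (S', b) = 0"
  shows "(\<Sum>q\<in>queries \<Q>. f q) = (\<Sum>b\<in>sign_strings S. f (S, b))"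
proof -
  have "finite \<Q>" using assms(1) by (rule finite_subset) simp
  hence "(\<Sum>q\<in>queries \<Q>. f q) = (\<Sum>S'\<in>\<Q>. if S' = S then \<Sum>b\<in>sign_strings S. f (S, b) else 0)"
    unfolding sum_queries[OF assms(1)] using assms(3) by (intro sum.cong refl) auto
  thus ?thesis using assms(2) \<open>finite \<Q>\<close> by simp
qed

text \<open>One bit is learnt per stage. Given the first \<open>j\<close> bits, the witness guesses
  the prefix of length \<open>j + 1\<close> with either value of the last bit; both guesses separate
  a pair that first differs there, and each contributes 1/2.\<close>

lemma prefix_upper_bound:
  assumes n: "1 \<le> n"
  shows "Q_rec n {{1..i} | i. 1 \<le> i \<and> i \<le> n} \<le> ereal (37 * real n)"
proof -
  define \<Q> where "\<Q> = {{1..i} | i. 1 \<le> i \<and> i \<le> n}"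
  have \<Q>: "\<Q> \<subseteq> Pow {1..n}" "\<Q> \<noteq> {}" using n by (auto simp: \<Q>_def)
  have fin: "finite \<Q>" using \<Q>(1) by (rule finite_subset) simp
  define \<gamma> :: "nat \<Rightarrow> (nat \<Rightarrow> int) \<Rightarrow> nat set \<times> (nat \<Rightarrow> int) \<Rightarrow> real" where "\<gamma> = (\<lambda>(j::nat) x (S, b). if S = {1..Suc j} \<and> (\<forall>i\<in>{1..j}. x i = b i) then 1 / sqrt 2 else 0 :: real)"
  have mem: "{1..Suc j} \<in> \<Q>" if "j < n" for j using that by (auto simp: \<Q>_def)
  show ?thesis
    unfolding \<Q>_def[symmetric]
  proof (rule sequential_upper_bound[OF \<Q>, where m = n and k = 1 and \<gamma> = \<gamma> and L = 1])
    fix j :: nat and x y assume xy: "x \<in> sign_strings {1..n}" "y \<in> sign_strings {1..n}" and j: "j < n"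
      and eq: "\<forall>i\<in>{1..j * 1}. x i = y i"
    have "(\<Sum>q\<in>queries \<Q>. if ans x q \<noteq> ans y q then \<gamma> j x q * \<gamma> j y q else 0) =
        (\<Sum>S\<in>\<Q>. if S = {1..Suc j} then if \<forall>i\<in>{1..Suc j}. x i = y i then 0 else 1 else 0)"
      unfolding sum_queries_differ[OF \<Q>(1) xy]
    proof (intro sum.cong refl)
      fix S assume "S \<in> \<Q>"
      show "(if \<forall>i\<in>S. x i = y i then 0 else \<gamma> j x (S, restrict x S) * \<gamma> j y (S, restrict x S) +
            \<gamma> j x (S, restrict y S) * \<gamma> j y (S, restrict y S)) =
          (if S = {1..Suc j} then if \<forall>i\<in>{1..Suc j}. x i = y i then 0 else 1 else 0)"
        using eq by (cases "S = {1..Suc j}") (simp_all add: \<gamma>_def)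
    qed
    also have "\<dots> = (if \<forall>i\<in>{1..Suc j * 1}. x i = y i then 0 else 1)"
      using fin mem[OF j] by simp
    finally show "(\<Sum>q\<in>queries \<Q>. if ans x q \<noteq> ans y q then \<gamma> j x q * \<gamma> j y q else 0) = \<dots>" .
  next
    fix j :: nat and x assume x: "x \<in> sign_strings {1..n}" and j: "j < n"
    let ?S = "{1..Suc j}"
    \<comment> \<open>The two guesses consistent with the known prefix; only these carry witness
      weight.\<close>
    let ?R = "{restrict x ?S, (restrict x ?S)(Suc j := - x (Suc j))}"
    have "(\<Sum>q\<in>queries \<Q>. (\<gamma> j x q)\<^sup>2) = (\<Sum>b\<in>sign_strings ?S. (\<gamma> j x (?S, b))\<^sup>2)"
      by (rule sum_queries_single[OF \<Q>(1) mem[OF j]]) (simp add: \<gamma>_def)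
    also have "\<dots> \<le> (\<Sum>b\<in>sign_strings ?S. if b \<in> ?R then 1 / 2 else 0)"
    proof (intro sum_mono)
      fix b assume b: "b \<in> sign_strings ?S"
      have "b \<in> ?R" if eq: "\<forall>i\<in>{1..j}. x i = b i"
      proof (cases "b (Suc j) = x (Suc j)")
        case True
        have "b = restrict x ?S"
          using b True eq by (auto simp: fun_eq_iff sign_strings_def PiE_iff extensional_def le_Suc_eq)
        thus ?thesis by simp
      next
        case False
        have "b (Suc j) \<in> {-1, 1}" "x (Suc j) \<in> {-1, 1}"
          using b x j by (auto simp: sign_strings_def PiE_iff)
        hence "b (Suc j) = - x (Suc j)" using False by auto
        hence "b = (restrict x ?S)(Suc j := - x (Suc j))"
          using b eq by (auto simp: fun_eq_iff sign_strings_def PiE_iff extensional_def le_Suc_eq)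
        thus ?thesis by simp
      qed
      thus "(\<gamma> j x (?S, b))\<^sup>2 \<le> (if b \<in> ?R then 1 / 2 else 0)"
        by (auto simp: \<gamma>_def power_divide)
    qed
    also have "\<dots> = (\<Sum>b\<in>sign_strings ?S \<inter> ?R. 1 / 2)"
      by (subst sum.inter_restrict) (auto simp: finite_sign_strings)
    also have "\<dots> \<le> (\<Sum>b\<in>?R. 1 / 2)" by (rule sum_mono2) auto
    also have "\<dots> \<le> 1" using card_insert_le_m1[of 2 "{(restrict x ?S)(Suc j := - x (Suc j))}" "restrict x ?S"]
      by simp
    finally show "(\<Sum>q\<in>queries \<Q>. (\<gamma> j x q)\<^sup>2) \<le> 1" .
  qed (use n in auto)
qed

section \<open>Random subsets that meet an unknown set exactly once\<close>

text \<open>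
  \<open>subset_weight s M\<close> is \<open>\<integral>p\<^sup>s\<^sup>-\<^sup>1(1-p)\<^sup>M\<^sup>-\<^sup>s dp\<close> over \<open>[0,1]\<close>: it averages, with density \<open>1/p\<close>, over the
  probability with which coordinates are put into the random set.
\<close>

definition subset_weight :: "nat \<Rightarrow> nat \<Rightarrow> real" where
  "subset_weight s M = fact (s - 1) * fact (M - s) / fact M"

text \<open>Under the integral this is (1 - p) + p = 1: one more coordinate is either left out or
  put in.\<close>

lemma subset_weight_add:
  assumes "1 \<le> s" "s < M"
  shows "subset_weight s M + subset_weight (Suc s) M = subset_weight s (M - 1)"
proof -
  obtain a where s: "s = Suc a" using assms by (cases s) auto
  obtain c where "M = Suc (s + c)" using assms less_iff_Suc_add by auto
  then obtain N where M: "M = Suc N" and N: "N = Suc (a + c)" using s by simp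
  have "subset_weight s M = fact a * fact c / fact N * (real (Suc c) / real (Suc N))"
    "subset_weight (Suc s) M = fact a * fact c / fact N * (real (Suc a) / real (Suc N))"
    "subset_weight s (M - 1) = fact a * fact c / fact N"
    unfolding subset_weight_def M s by (simp_all add: N Suc_diff_le del: of_nat_Suc fact_Suc) (simp_all add: mult_ac)
  moreover have "real (Suc c) / real (Suc N) + real (Suc a) / real (Suc N) = 1"
    by (simp add: N flip: add_divide_distrib)
  ultimately show ?thesis by (simp only: distrib_left[symmetric] mult_1_right)
qed

text \<open>Marginalisation: the coordinates in \<open>G\<close> are summed out one by one.\<close>

lemma sum_Pow_subset_weight:
  assumes "finite G" "1 \<le> s" "card G + s \<le> M"
  shows "(\<Sum>R\<in>Pow G. subset_weight (card R + s) M) = subset_weight s (M - card G)"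
  using assms
proof (induction G arbitrary: s rule: finite_induct)
  case (insert a G)
  have "(\<Sum>R\<in>Pow (insert a G). subset_weight (card R + s) M) =
      (\<Sum>R\<in>Pow G. subset_weight (card R + s) M) + (\<Sum>R\<in>insert a ` Pow G. subset_weight (card R + s) M)"
    using insert.hyps unfolding Pow_insert by (subst sum.union_disjoint) auto
  also have "(\<Sum>R\<in>insert a ` Pow G. subset_weight (card R + s) M) = (\<Sum>R\<in>Pow G. subset_weight (card R + Suc s) M)"
    using insert.hyps by (subst sum.reindex)
      (auto simp: inj_on_def card_insert_if finite_subset subset_iff intro!: sum.cong)
  also have "(\<Sum>R\<in>Pow G. subset_weight (card R + s) M) + (\<Sum>R\<in>Pow G. subset_weight (card R + Suc s) M) =
      subset_weight s (M - card G) + subset_weight (Suc s) (M - card G)"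
    using insert.IH[of s] insert.IH[of "Suc s"] insert.hyps insert.prems by simp
  also have "\<dots> = subset_weight s (M - card (insert a G))"
    using insert by (subst subset_weight_add) auto
  finally show ?case .
qed simp

text \<open>The density 1/p makes the total independent of the unknown set \<open>D\<close>: the
  integral of |D| (1 - p)^(|D| - 1) over [0,1] is 1. In the discrete form, \<open>S\<close> consists
  of one of the |D| elements and an arbitrary part outside \<open>D\<close>; summing the latter out
  leaves 1 / |D| for each element.\<close>

lemma sum_subset_weight_meet_once:
  assumes A: "finite A" and D: "D \<subseteq> A" "D \<noteq> {}"
  shows "(\<Sum>S | S \<subseteq> A \<and> card (S \<inter> D) = 1. subset_weight (card S) (card A)) = 1"
proof -
  have fin: "finite D" "finite (A - D)" using A D by (auto intro: finite_subset)
  have "(\<Sum>S | S \<subseteq> A \<and> card (S \<inter> D) = 1. subset_weight (card S) (card A)) =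
      (\<Sum>(i, R)\<in>D \<times> Pow (A - D). subset_weight (card R + 1) (card A))"
  proof (rule sum.reindex_bij_witness[where i = "\<lambda>(i, R). insert i R" and j = "\<lambda>S. (the_elem (S \<inter> D), S - D)"])
    fix S assume S: "S \<in> {S. S \<subseteq> A \<and> card (S \<inter> D) = 1}"
    then obtain i where i: "S \<inter> D = {i}" by (auto simp: card_1_singleton_iff)
    hence Si: "S = insert i (S - D)" "i \<in> D" "i \<notin> S - D" by auto
    show "(case (the_elem (S \<inter> D), S - D) of (i, R) \<Rightarrow> insert i R) = S"
      using i Si by auto
    show "(the_elem (S \<inter> D), S - D) \<in> D \<times> Pow (A - D)" using i Si S by auto
    have "card S = Suc (card (S - D))"
      using Si S A by (metis (no_types, lifting) card_insert_disjoint finite_Diff finite_subset mem_Collect_eq)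
    thus "(case (the_elem (S \<inter> D), S - D) of (i, R) \<Rightarrow> subset_weight (card R + 1) (card A)) = subset_weight (card S) (card A)"
      by simp
  next
    fix p assume "p \<in> D \<times> Pow (A - D)"
    then obtain i R where p: "p = (i, R)" "i \<in> D" "R \<subseteq> A - D" by auto
    hence *: "insert i R \<inter> D = {i}" "insert i R - D = R" by auto
    thus "(the_elem ((case p of (i, R) \<Rightarrow> insert i R) \<inter> D), (case p of (i, R) \<Rightarrow> insert i R) - D) = p"
      "(case p of (i, R) \<Rightarrow> insert i R) \<in> {S. S \<subseteq> A \<and> card (S \<inter> D) = 1}"
      using p D by (auto simp: * simp del: Int_insert_left_if1 insert_Diff1)
  qed
  also have "\<dots> = real (card D) * (\<Sum>R\<in>Pow (A - D). subset_weight (card R + 1) (card A))"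
    by (subst sum.cartesian_product[symmetric]) simp
  also have "card (A - D) + 1 \<le> card A"
    using psubset_card_mono[OF A, of "A - D"] D by (simp add: Suc_le_eq) blast
  hence "(\<Sum>R\<in>Pow (A - D). subset_weight (card R + 1) (card A)) = subset_weight 1 (card A - card (A - D))"
    using fin by (intro sum_Pow_subset_weight) auto
  also have "card A - card (A - D) = card D"
    using A D fin card_mono[of A D] by (simp add: card_Diff_subset)
  also have "real (card D) * subset_weight 1 (card D) = 1"
    using fin D by (cases "card D") (auto simp: subset_weight_def)
  finally show ?thesis .
qed

lemma sum_inverse_sqrt_le: "(\<Sum>s=1..m. 1 / sqrt (real s)) \<le> 2 * sqrt (real m)"
proof (induction m)
  case (Suc m)
  have "1 / sqrt (real (Suc m)) \<le> 2 * sqrt (real (Suc m)) - 2 * sqrt (real m)"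
  proof -
    have "0 \<le> (sqrt (real (Suc m)) - sqrt (real m))\<^sup>2" by simp
    hence "2 * (sqrt (real m) * sqrt (real (Suc m))) \<le> 2 * real (Suc m) - 1"
      by (simp add: power2_diff mult_ac)
    hence "1 \<le> (2 * sqrt (real (Suc m)) - 2 * sqrt (real m)) * sqrt (real (Suc m))"
      by (simp add: left_diff_distrib mult.assoc)
    thus ?thesis by (simp add: pos_divide_le_eq)
  qed
  thus ?case using Suc by simp
qed simp

text \<open>All sets of size \<open>s\<close> together have weight \<open>1 / s\<close>, so each
  size contributes \<open>1 / sqrt s\<close>.\<close>

lemma sum_subset_weight_sqrt_le:
  assumes A: "finite A"
  shows "(\<Sum>S\<in>Pow A. if S = {} then 0 else subset_weight (card S) (card A) * sqrt (card S)) \<le> 2 * sqrt (card A)"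
proof -
  let ?m = "card A"
  have "(\<Sum>S\<in>Pow A. if S = {} then 0 else subset_weight (card S) ?m * sqrt (card S)) =
      (\<Sum>s\<le>?m. \<Sum>S\<in>{S \<in> Pow A. card S = s}. if S = {} then 0 else subset_weight (card S) ?m * sqrt (card S))"
    using A by (intro sum.group[symmetric]) (auto simp: card_mono)
  also have "\<dots> = (\<Sum>s\<le>?m. if s = 0 then 0 else 1 / sqrt s)"
  proof (intro sum.cong refl)
    fix s assume s: "s \<in> {..?m}"
    have "(\<Sum>S\<in>{S \<in> Pow A. card S = s}. if S = {} then 0 else subset_weight (card S) ?m * sqrt (card S)) =
        (\<Sum>S\<in>{S \<in> Pow A. card S = s}. if s = 0 then 0 else subset_weight s ?m * sqrt s)"
      using A by (intro sum.cong refl) (auto dest: finite_subset)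
    also have "\<dots> = real (?m choose s) * (if s = 0 then 0 else subset_weight s ?m * sqrt s)"
      using n_subsets[OF A, of s] by simp
    also have "\<dots> = (if s = 0 then 0 else 1 / sqrt s)"
    proof (cases s)
      case (Suc r)
      have "real (?m choose s) = fact ?m / (fact s * fact (?m - s))"
        using s by (simp add: binomial_fact)
      hence "real (?m choose s) * (subset_weight s ?m * sqrt s) = sqrt s / s"
        by (simp add: subset_weight_def Suc field_simps del: of_nat_Suc)
      thus ?thesis using Suc by (simp add: sqrt_divide_self_eq inverse_eq_divide)
    qed simp
    finally show "(\<Sum>S\<in>{S \<in> Pow A. card S = s}. if S = {} then 0 else subset_weight (card S) ?m * sqrt (card S)) =
        (if s = 0 then 0 else 1 / sqrt s)" .
  qed
  also have "\<dots> = (\<Sum>s=1..?m. 1 / sqrt s)"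
    by (rule sum.mono_neutral_cong_right) auto
  also have "\<dots> \<le> 2 * sqrt ?m" by (rule sum_inverse_sqrt_le)
  finally show ?thesis .
qed

section \<open>The witness for sets of bounded size\<close>

definition block :: "nat \<Rightarrow> nat \<Rightarrow> nat \<Rightarrow> nat set" where
  "block n k j = {j * k + 1..Suc j * k} \<inter> {1..n}"

lemma card_block_le: "card (block n k j) \<le> k"
  using card_mono[of "{j * k + 1..Suc j * k}" "block n k j"] by (simp add: block_def)

lemma finite_block: "finite (block n k j)"
  by (simp add: block_def)

text \<open>
  The product \<open>hit * miss\<close> is dictated by \<open>sum_subset_weight_meet_once\<close>; the ratio makes the \<open>s\<close> answers at
  distance 1 together cost as much as the single correct one.
\<close>

definition hit :: "nat \<Rightarrow> nat \<Rightarrow> real" where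
  "hit s m = sqrt (subset_weight s m * sqrt s / 2)"

definition miss :: "nat \<Rightarrow> nat \<Rightarrow> real" where
  "miss s m = sqrt (subset_weight s m / (2 * sqrt s))"

lemma subset_weight_nonneg: "subset_weight s m \<ge> 0"
  by (simp add: subset_weight_def)

lemma hit_times_miss: "s > 0 \<Longrightarrow> hit s m * miss s m = subset_weight s m / 2"
proof -
  assume "s > 0"
  hence "subset_weight s m * sqrt s / 2 * (subset_weight s m / (2 * sqrt s)) = (subset_weight s m / 2)\<^sup>2"
    by (simp add: power2_eq_square)
  thus ?thesis
    unfolding hit_def miss_def real_sqrt_mult[symmetric] by (simp only:) (simp add: subset_weight_nonneg)
qed

definition block_witness :: "nat \<Rightarrow> nat \<Rightarrow> nat \<Rightarrow> (nat \<Rightarrow> int) \<Rightarrow> nat set \<times> (nat \<Rightarrow> int) \<Rightarrow> real" where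
  "block_witness n k j x = (\<lambda>(S, b). if S \<noteq> {} \<and> S \<subseteq> block n k j then
      if restrict x S = b then hit (card S) (card (block n k j))
      else if card {i \<in> S. x i \<noteq> b i} = 1 then miss (card S) (card (block n k j)) else 0
    else 0)"

text \<open>With \<open>D\<close> the differences inside the block, the two separating guesses for
  \<open>S\<close> have nonzero product only if \<open>S\<close> meets \<open>D\<close> in one
  coordinate. Each then gives \<open>hit * miss\<close>, together \<open>subset_weight\<close>, and
  these sum to 1 by \<open>sum_subset_weight_meet_once\<close>.\<close>

lemma block_witness_separates:
  assumes \<Q>: "\<Q> \<subseteq> Pow {1..n}" and sub: "\<And>S. S \<subseteq> {1..n} \<Longrightarrow> S \<noteq> {} \<Longrightarrow> card S \<le> k \<Longrightarrow> S \<in> \<Q>"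
    and x: "x \<in> sign_strings {1..n}" and y: "y \<in> sign_strings {1..n}"
    and eq: "\<forall>i\<in>{1..j * k}. x i = y i"
  shows "(\<Sum>q\<in>queries \<Q>. if ans x q \<noteq> ans y q then block_witness n k j x q * block_witness n k j y q else 0) =
      (if \<forall>i\<in>{1..Suc j * k}. x i = y i then 0 else 1)"
proof -
  let ?A = "block n k j"
  define D where "D = {i \<in> ?A. x i \<noteq> y i}"
  have fin: "finite \<Q>" using \<Q> by (rule finite_subset) simp
  have A\<Q>: "S \<in> \<Q>" if "S \<subseteq> ?A" "S \<noteq> {}" for S
    using that card_mono[OF finite_block that(1)] card_block_le[of n k j]
    by (intro sub) (auto simp: block_def)
  have "(\<Sum>q\<in>queries \<Q>. if ans x q \<noteq> ans y q then block_witness n k j x q * block_witness n k j y q else 0) =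
      (\<Sum>S\<in>\<Q>. if S \<subseteq> ?A \<and> card (S \<inter> D) = 1 then subset_weight (card S) (card ?A) else 0)"
    unfolding sum_queries_differ[OF \<Q> x y]
  proof (intro sum.cong refl)
    fix S assume S: "S \<in> \<Q>"
    let ?w = "\<lambda>z b. block_witness n k j z (S, b)"
    show "(if \<forall>i\<in>S. x i = y i then 0 else ?w x (restrict x S) * ?w y (restrict x S) + ?w x (restrict y S) * ?w y (restrict y S)) =
        (if S \<subseteq> ?A \<and> card (S \<inter> D) = 1 then subset_weight (card S) (card ?A) else 0)"
    proof (cases "S \<subseteq> ?A \<and> (\<exists>i\<in>S. x i \<noteq> y i)")
      case True
      hence finS: "finite S" using finite_block finite_subset by blast
      have SD: "{i \<in> S. x i \<noteq> y i} = S \<inter> D" "{i \<in> S. y i \<noteq> x i} = S \<inter> D"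
        using True by (auto simp: D_def)
      have ne: "S \<noteq> {}" "restrict x S \<noteq> restrict y S" "restrict y S \<noteq> restrict x S"
        using True by (auto simp: restrict_eq_iff) metis
      have r: "{i \<in> S. x i \<noteq> restrict y S i} = S \<inter> D" "{i \<in> S. y i \<noteq> restrict x S i} = S \<inter> D"
        using SD by auto
      have w: "?w x (restrict x S) = hit (card S) (card ?A)" "?w y (restrict y S) = hit (card S) (card ?A)"
        "?w x (restrict y S) = (if card (S \<inter> D) = 1 then miss (card S) (card ?A) else 0)"
        "?w y (restrict x S) = (if card (S \<inter> D) = 1 then miss (card S) (card ?A) else 0)"
        using True ne unfolding block_witness_def prod.case r by simp_all
      have hm: "hit (card S) (card ?A) * miss (card S) (card ?A) = subset_weight (card S) (card ?A) / 2"
        using ne finS by (intro hit_times_miss) (simp add: card_gt_0_iff)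
      show ?thesis
        using True hm unfolding w by (simp add: mult.commute) blast
    next
      case False
      have "S \<inter> D = {}" if "S \<subseteq> ?A" using that False by (auto simp: D_def)
      thus ?thesis using False by (auto simp: block_witness_def)
    qed
  qed
  also have "\<dots> = (\<Sum>S | S \<subseteq> ?A \<and> card (S \<inter> D) = 1. subset_weight (card S) (card ?A))"
  proof (rule sum.mono_neutral_cong_right[OF fin])
    show "{S. S \<subseteq> ?A \<and> card (S \<inter> D) = 1} \<subseteq> \<Q>"
    proof safe
      fix S assume "S \<subseteq> ?A" "card (S \<inter> D) = 1"
      thus "S \<in> \<Q>" by (intro A\<Q>) auto
    qed
  qed auto
  also have "\<dots> = (if D = {} then 0 else 1)"
  proof (cases "D = {}")
    case False
    have "D \<subseteq> ?A" by (auto simp: D_def)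
    thus ?thesis using sum_subset_weight_meet_once[OF finite_block _ False] False by simp
  qed simp
  \<comment> \<open>Positions before the block agree by \<open>eq\<close>; positions beyond
    \<open>n\<close> agree because both strings are undefined there.\<close>
  also have "D = {} \<longleftrightarrow> (\<forall>i\<in>{1..Suc j * k}. x i = y i)"
  proof
    assume D: "D = {}"
    show "\<forall>i\<in>{1..Suc j * k}. x i = y i"
    proof
      fix i assume i: "i \<in> {1..Suc j * k}"
      show "x i = y i"
      proof (cases "i \<le> n")
        case True
        thus ?thesis using D eq i by (cases "i \<le> j * k") (auto simp: D_def block_def)
      next
        case False
        thus ?thesis using x y by (simp add: sign_strings_def PiE_def extensional_def)
      qed
    qed
  qed (auto simp: D_def block_def)
  finally show ?thesis .
qed

lemma card_hamming_sphere_le: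
  assumes S: "finite S" and x: "x \<in> sign_strings S"
  shows "card {b \<in> sign_strings S. card {i \<in> S. x i \<noteq> b i} = 1} \<le> card S"
proof -
  have "{b \<in> sign_strings S. card {i \<in> S. x i \<noteq> b i} = 1} \<subseteq> (\<lambda>i. x(i := - x i)) ` S"
  proof
    fix b assume "b \<in> {b \<in> sign_strings S. card {i \<in> S. x i \<noteq> b i} = 1}"
    then obtain i where b: "b \<in> sign_strings S" and i: "{l \<in> S. x l \<noteq> b l} = {i}"
      by (auto simp: card_1_singleton_iff)
    hence iS: "i \<in> S" "x i \<noteq> b i" by auto
    moreover have "b i \<in> {-1, 1}" "x i \<in> {-1, 1}" using iS b x by (auto simp: sign_strings_def PiE_iff)
    ultimately have bi: "b i = - x i" by auto
    have "b l = (x(i := - x i)) l" for l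
    proof (cases "l \<in> S")
      case True
      hence "x l = b l" if "l \<noteq> i" using i that by blast
      thus ?thesis using bi by auto
    next
      case False
      thus ?thesis using iS b x by (auto simp: sign_strings_def PiE_iff extensional_def)
    qed
    thus "b \<in> (\<lambda>i. x(i := - x i)) ` S" using iS by (intro image_eqI[of _ _ i]) auto
  qed
  thus ?thesis using S by (meson card_image_le card_mono finite_imageI order_trans)
qed

text \<open>The correct guess costs \<open>hit\<close> squared and the \<open>s\<close> guesses at
  distance 1 cost \<open>s\<close> times \<open>miss\<close> squared. These are equal and add up to
  \<open>subset_weight\<close> times \<open>sqrt s\<close>.\<close>

lemma block_witness_cost:
  assumes \<Q>: "\<Q> \<subseteq> Pow {1..n}" and x: "x \<in> sign_strings {1..n}"
  shows "(\<Sum>q\<in>queries \<Q>. (block_witness n k j x q)\<^sup>2) \<le> 2 * sqrt k"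
proof -
  let ?A = "block n k j"
  have fin: "finite \<Q>" using \<Q> by (rule finite_subset) simp
  have "(\<Sum>q\<in>queries \<Q>. (block_witness n k j x q)\<^sup>2) \<le>
      (\<Sum>S\<in>\<Q>. if S \<subseteq> ?A \<and> S \<noteq> {} then subset_weight (card S) (card ?A) * sqrt (card S) else 0)"
    unfolding sum_queries[OF \<Q>]
  proof (intro sum_mono)
    fix S assume "S \<in> \<Q>"
    hence S: "S \<subseteq> {1..n}" "finite S" using \<Q> by (auto intro: finite_subset)
    let ?h = "hit (card S) (card ?A)" and ?m = "miss (card S) (card ?A)" and ?r = "restrict x S"
    let ?N = "{b \<in> sign_strings S. card {i \<in> S. ?r i \<noteq> b i} = 1}"
    show "(\<Sum>b\<in>sign_strings S. (block_witness n k j x (S, b))\<^sup>2) \<le>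
      (if S \<subseteq> ?A \<and> S \<noteq> {} then subset_weight (card S) (card ?A) * sqrt (card S) else 0)"
    proof (cases "S \<subseteq> ?A \<and> S \<noteq> {}")
      case True
      have eq: "{i \<in> S. x i \<noteq> b i} = {i \<in> S. ?r i \<noteq> b i}" for b by auto
      have r: "?r \<in> sign_strings S" by (rule restrict_sign_strings[OF x S(1)])
      have "(\<Sum>b\<in>sign_strings S. (block_witness n k j x (S, b))\<^sup>2) \<le>
          (\<Sum>b\<in>sign_strings S. (if ?r = b then ?h\<^sup>2 else 0) + (if card {i \<in> S. ?r i \<noteq> b i} = 1 then ?m\<^sup>2 else 0))"
        using True unfolding block_witness_def prod.case eq by (intro sum_mono) auto
      also have "\<dots> = ?h\<^sup>2 + real (card ?N) * ?m\<^sup>2"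
        using r S by (simp add: sum.distrib finite_sign_strings sum.inter_filter[symmetric])
      also have "\<dots> \<le> ?h\<^sup>2 + real (card S) * ?m\<^sup>2"
        using card_hamming_sphere_le[OF S(2) r] by (intro add_left_mono mult_right_mono) auto
      also have "\<dots> = subset_weight (card S) (card ?A) * sqrt (card S)"
        using True S by (simp add: hit_def miss_def subset_weight_nonneg real_sqrt_pow2 field_simps)
      finally show ?thesis using True by simp
    next
      case False
      have "block_witness n k j x (S, b) = 0" for b
        using False by (auto simp: block_witness_def)
      thus ?thesis by (simp only: if_not_P[OF False]) simp
    qed
  qed
  also have "\<dots> \<le> (\<Sum>S\<in>Pow ?A. if S = {} then 0 else subset_weight (card S) (card ?A) * sqrt (card S))"
  proof -
    have "(\<Sum>S\<in>\<Q>. if S \<subseteq> ?A \<and> S \<noteq> {} then subset_weight (card S) (card ?A) * sqrt (card S) else 0) =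
        (\<Sum>S\<in>\<Q> \<inter> Pow ?A. if S = {} then 0 else subset_weight (card S) (card ?A) * sqrt (card S))"
      using fin by (intro sum.mono_neutral_cong_right) auto
    also have "\<dots> \<le> (\<Sum>S\<in>Pow ?A. if S = {} then 0 else subset_weight (card S) (card ?A) * sqrt (card S))"
      by (intro sum_mono2) (auto simp: finite_block subset_weight_nonneg)
    finally show ?thesis .
  qed
  also have "\<dots> \<le> 2 * sqrt (card ?A)" by (rule sum_subset_weight_sqrt_le[OF finite_block])
  also have "\<dots> \<le> 2 * sqrt k" using card_block_le[of n k j] by simp
  finally show ?thesis .
qed

text \<open>The family is only required to contain the small nonempty sets, so that the case
  \<open>k = 1\<close> also covers intervals.\<close>

lemma small_sets_upper_bound:
  assumes \<Q>: "\<Q> \<subseteq> Pow {1..n}" and sub: "\<And>S. S \<subseteq> {1..n} \<Longrightarrow> S \<noteq> {} \<Longrightarrow> card S \<le> k \<Longrightarrow> S \<in> \<Q>"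
    and k: "1 \<le> k" "k \<le> n"
  shows "Q_rec n \<Q> \<le> ereal (148 * (real n / sqrt (real k)))"
proof -
  have "{1} \<in> \<Q>" using k by (intro sub) auto
  hence ne: "\<Q> \<noteq> {}" by auto
  have sq: "sqrt (real k) * sqrt (real k) = k" "sqrt (real k) > 0" using k by auto
  have "Q_rec n \<Q> \<le> ereal (37 * (4 * (real n / sqrt (real k))))"
  \<comment> \<open>\<open>n div k + 1\<close> blocks, the last possibly short or empty, have total
    length at most \<open>2 * n\<close>. At cost \<open>2 * sqrt k\<close> each this sums to at most
    \<open>4 * n / sqrt k\<close>.\<close>
  proof (rule sequential_upper_bound[OF \<Q> ne, where m = "n div k + 1" and k = k and \<gamma> = "block_witness n k" and L = "2 * sqrt k"])
    show "n \<le> (n div k + 1) * k"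
      using k div_mult_mod_eq[of n k] mod_less_divisor[of k n] by (simp add: distrib_right, linarith)
    show "real (n div k + 1) * (2 * sqrt k) \<le> 4 * (real n / sqrt k)"
    proof -
      have "real (n div k) * k \<le> n"
        using div_times_less_eq_dividend[of n k] by (metis of_nat_le_iff of_nat_mult)
      hence le: "real (n div k + 1) * k \<le> 2 * real n" using k by (simp add: distrib_right)
      have "real (n div k + 1) * (2 * sqrt k) * sqrt k = 2 * (real (n div k + 1) * (sqrt k * sqrt k))"
        by (simp only: mult_ac)
      also have "\<dots> \<le> 4 * real n" unfolding sq(1) using le by linarith
      finally have "real (n div k + 1) * (2 * sqrt k) * sqrt k \<le> 4 * real n" .
      thus ?thesis using sq(2) by (simp add: pos_le_divide_eq)
    qed
    show "1 \<le> 4 * (real n / sqrt k)"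
    proof -
      have "sqrt k \<le> sqrt k * sqrt k" using k mult_left_mono[of 1 "sqrt k" "sqrt k"] by simp
      also have "\<dots> \<le> 4 * real n" using sq k by simp
      finally show ?thesis using sq(2) by (simp add: field_simps)
    qed
  qed (rule block_witness_separates[OF \<Q> sub] block_witness_cost[OF \<Q>]; assumption)+
  thus ?thesis by simp
qed

section \<open>Hard weights for reconstruction\<close>

text \<open>If some number of queries suffices, the infimum is attained because \<open>enat\<close>
  is well-ordered; otherwise the value is infinite.\<close>

lemma Q_rec_ge:
  assumes "\<And>T. computes_in n \<Q> (sign_strings {1..n}) (\<lambda>x. x) T \<Longrightarrow> c \<le> real T"
  shows "ereal c \<le> Q_rec n \<Q>"
proof -
  let ?A = "enat ` {T. computes_in n \<Q> (sign_strings {1..n}) (\<lambda>x. x) T}"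
  show ?thesis
  proof (cases "?A = {}")
    case True
    hence "Q_rec n \<Q> = \<infinity>" unfolding Q_rec_def quantum_query_complexity_def True by (simp add: top_enat_def)
    thus ?thesis by simp
  next
    case False
    hence "Inf ?A \<in> ?A" by (meson all_not_in_conv wellorder_InfI)
    then obtain T where T: "Inf ?A = enat T" "computes_in n \<Q> (sign_strings {1..n}) (\<lambda>x. x) T" by blast
    hence "Q_rec n \<Q> = ereal (real T)" by (simp only: Q_rec_def quantum_query_complexity_def) simp
    thus ?thesis using assms[OF T(2)] by simp
  qed
qed

lemma card_cylinder:
  assumes V: "finite V" and A: "A \<subseteq> V" and z: "z \<in> sign_strings V"
  shows "card {y \<in> sign_strings V. \<forall>i\<in>A. y i = z i} = 2 ^ card (V - A)"
proof -
  have "bij_betw (\<lambda>y. restrict y (V - A)) {y \<in> sign_strings V. \<forall>i\<in>A. y i = z i} (sign_strings (V - A))"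
  proof (rule bij_betwI[where g = "\<lambda>b i. if i \<in> A then z i else b i"])
    show "(\<lambda>y. restrict y (V - A)) \<in> {y \<in> sign_strings V. \<forall>i\<in>A. y i = z i} \<rightarrow> sign_strings (V - A)"
      by (auto simp: sign_strings_def PiE_iff)
    show "(\<lambda>b i. if i \<in> A then z i else b i) \<in> sign_strings (V - A) \<rightarrow> {y \<in> sign_strings V. \<forall>i\<in>A. y i = z i}"
      using A z by (auto simp: sign_strings_def PiE_iff extensional_def)
    show "(\<lambda>i. if i \<in> A then z i else restrict y (V - A) i) = y"
      if "y \<in> {y \<in> sign_strings V. \<forall>i\<in>A. y i = z i}" for y
      using that by (auto simp: fun_eq_iff sign_strings_def PiE_iff extensional_def)
    show "restrict (\<lambda>i. if i \<in> A then z i else b i) (V - A) = b"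
      if "b \<in> sign_strings (V - A)" for b
      using that by (auto simp: fun_eq_iff sign_strings_def PiE_iff extensional_def)
  qed
  thus ?thesis using V by (simp add: bij_betw_same_card card_sign_strings)
qed

section \<open>Weights on blocks of coordinates\<close>

lemma card_block_eq:
  assumes "j < n div L"
  shows "card (block n L j) = L"
proof -
  have "Suc j * L \<le> n div L * L" using assms by (intro mult_right_mono) auto
  also have "\<dots> \<le> n" by (rule div_times_less_eq_dividend)
  finally have "block n L j = {j * L + 1..Suc j * L}" by (auto simp: block_def)
  thus ?thesis by simp
qed

lemma block_disjoint:
  assumes "i \<in> block n L j" "i \<in> block n L j'"
  shows "j = j'"
proof -
  have *: "(i - 1) div L = l" if "i \<in> block n L l" for l
    using that by (intro div_nat_eqI) (auto simp: block_def algebra_simps)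
  show ?thesis using *[OF assms(1)] *[OF assms(2)] by simp
qed

text \<open>
  The weight joins strings that differ within a single block.  A pair whose block is contained in
  the queried set gets ratio \<open>a\<close> because such a query has only one matching neighbour of any
  non-matching string; a block that is merely cut is charged 1 in both directions.
\<close>

lemma block_lower_bound:
  fixes a R :: real
  assumes \<Q>: "\<Q> \<subseteq> Pow {1..n}" and L: "1 \<le> L" and a: "0 < a" "a \<le> 1"
    and R: "1 / (2 ^ L * a) \<le> R"
    and cost: "\<And>S. S \<in> \<Q> \<Longrightarrow> a * card {j. j < n div L \<and> block n L j \<subseteq> S} +
      card {j. j < n div L \<and> block n L j \<inter> S \<noteq> {} \<and> \<not> block n L j \<subseteq> S} \<le> R"
    and comp: "computes_in n \<Q> (sign_strings {1..n}) (\<lambda>x. x) T"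
  shows "real (n div L) / 2 \<le> 40 * R * real T"
proof -
  define X where "X = sign_strings {1..n}"
  define m where "m = n div L"
  define near where "near j x y \<longleftrightarrow> (\<forall>i\<in>{1..n} - block n L j. x i = y i)" for j and x y :: "nat \<Rightarrow> int"
  \<comment> \<open>The \<open>2 ^ L\<close> strings near \<open>x\<close> in one block get total
    weight 1; without \<open>x\<close> itself at least 1/2 remains, since
    \<open>1 \<le> L\<close>.\<close>
  define \<omega> :: real where "\<omega> = 1 / 2 ^ L"
  define w where "w x y = (\<Sum>j<m. if x \<noteq> y \<and> near j x y then \<omega> else 0)" for x y
  define full where "full S x y \<longleftrightarrow> (\<exists>j<m. block n L j \<subseteq> S \<and> near j x y)" for S x y
  define H where "H S x y = (if full S x y then a else 1)" for S x y
  \<comment> \<open>Exactly one string of a separated pair matches the query, so exchanging the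
    strings inverts the ratio.\<close>
  define h where "h q x y = (if restrict x (fst q) = snd q then H (fst q) x y else 1 / H (fst q) x y)"
    for q :: "nat set \<times> (nat \<Rightarrow> int)" and x y
  have X: "finite X" by (simp add: X_def finite_sign_strings)
  have \<omega>: "\<omega> > 0" by (simp add: \<omega>_def)
  have R0: "R > 0" by (rule less_le_trans[OF _ R]) (use a in simp)
  have near_sym: "near j x y \<longleftrightarrow> near j y x" for j x y by (auto simp: near_def)
  have H_sym: "H S x y = H S y x" for S x y by (simp add: H_def full_def near_sym)
  have H: "H S x y > 0" "H S x y \<le> 1" for S x y using a by (auto simp: H_def)
  have card_near: "card {y \<in> X. near j x y} = 2 ^ L" if "x \<in> X" "j < m" for x j
  proof -
    have "card {y \<in> X. near j x y} = 2 ^ card ({1..n} - ({1..n} - block n L j))"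
      unfolding near_def X_def eq_commute[of "x _"]
      by (rule card_cylinder) (use that in \<open>auto simp: X_def\<close>)
    also have "{1..n} - ({1..n} - block n L j) = block n L j" unfolding block_def by blast
    also have "card \<dots> = L" using that by (intro card_block_eq) (simp add: m_def)
    finally show ?thesis .
  qed
  have "real m / 2 \<le> 40 * R * real T"
  proof (rule weighted_adversary_lower_bound[OF \<Q> _ _ _ _ _ _ comp, of w h])
    show "w x y \<ge> 0" for x y using \<omega> by (auto simp: w_def intro: sum_nonneg)
    show "w x y = w y x" for x y by (simp add: w_def near_sym eq_commute)
    show "h q x y > 0" for q x y using H by (simp add: h_def)
    show "h q y x = 1 / h q x y" if "ans x q \<noteq> ans y q" for q x y
      using that by (auto simp: h_def answer_def H_sym split: if_splits)
  next
    fix x assume x: "x \<in> sign_strings {1..n}"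
    have "real m / 2 \<le> (\<Sum>j<m. (2 ^ L - 1) * \<omega>)"
    proof -
      have "(2::real) \<le> 2 ^ L" using L power_increasing[of 1 L "2::real"] by simp
      hence "1 / 2 \<le> (2 ^ L - 1) * \<omega>" by (simp add: \<omega>_def field_simps)
      thus ?thesis using mult_left_mono[of "1/2" "(2 ^ L - 1) * \<omega>" "real m"] by simp
    qed
    also have "\<dots> = (\<Sum>j<m. \<Sum>y\<in>X. if y \<noteq> x \<and> near j x y then \<omega> else 0)"
    proof (intro sum.cong refl)
      fix j assume j: "j \<in> {..<m}"
      have "{y \<in> X. y \<noteq> x \<and> near j x y} = {y \<in> X. near j x y} - {x}" by auto
      hence "card {y \<in> X. y \<noteq> x \<and> near j x y} = 2 ^ L - 1"
        using card_near[of x j] x j X by (simp add: X_def near_def)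
      thus "(2 ^ L - 1) * \<omega> = (\<Sum>y\<in>X. if y \<noteq> x \<and> near j x y then \<omega> else 0)"
        using X by (simp add: sum.inter_filter[symmetric])
    qed
    also have "\<dots> = (\<Sum>y\<in>X. \<Sum>j<m. if y \<noteq> x \<and> near j x y then \<omega> else 0)" by (rule sum.swap)
    also have "\<dots> = (\<Sum>y\<in>X. if y \<noteq> x then w x y else 0)"
      by (intro sum.cong refl) (auto simp: w_def)
    finally show "real m / 2 \<le> (\<Sum>y\<in>sign_strings {1..n}. if y \<noteq> x then w x y else 0)"
      by (simp add: X_def)
  next
    fix q x assume q: "q \<in> queries \<Q>" and x: "x \<in> sign_strings {1..n}"
    obtain S b where Sb: "q = (S, b)" "S \<in> \<Q>" "b \<in> sign_strings S" using q by auto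
    hence Sn: "S \<subseteq> {1..n}" using \<Q> by auto
    show "(\<Sum>y\<in>sign_strings {1..n}. if ans x q \<noteq> ans y q then w x y * h q x y else 0) \<le> R"
    proof (cases "restrict x S = b")
      case True
      \<comment> \<open>Here \<open>x\<close> matches. A separated neighbour differs on
        \<open>S\<close>, hence within a block meeting \<open>S\<close>, and \<open>c j\<close>
        bounds its ratio; the neighbours in block \<open>j\<close> together contribute at most
        \<open>c j\<close>.\<close>
      define c where "c j = (if block n L j \<subseteq> S then a else if block n L j \<inter> S \<noteq> {} then 1 else 0)" for j
      have "(\<Sum>y\<in>X. if ans x q \<noteq> ans y q then w x y * h q x y else 0) \<le>
          (\<Sum>y\<in>X. \<Sum>j<m. if near j x y then \<omega> * c j else 0)"
      proof (intro sum_mono)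
        fix y assume "y \<in> X"
        show "(if ans x q \<noteq> ans y q then w x y * h q x y else 0) \<le> (\<Sum>j<m. if near j x y then \<omega> * c j else 0)"
        proof (cases "ans x q = ans y q")
          case False
          hence ne: "\<exists>i\<in>S. x i \<noteq> y i"
            using restrict_eq_iff[of x S y] by (auto simp: answer_def Sb)
          have "w x y * h q x y = (\<Sum>j<m. if x \<noteq> y \<and> near j x y then \<omega> * H S x y else 0)"
            using True by (simp add: w_def h_def Sb sum_distrib_right) (auto intro: sum.cong)
          also have "\<dots> \<le> (\<Sum>j<m. if near j x y then \<omega> * c j else 0)"
          proof (intro sum_mono)
            fix j assume j: "j \<in> {..<m}"
            have "H S x y \<le> c j" if "near j x y"
            proof -
              have "block n L j \<inter> S \<noteq> {}" using ne that Sn by (auto simp: near_def)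
              moreover have "block n L j \<subseteq> S \<Longrightarrow> full S x y" using that j by (auto simp: full_def)
              ultimately show ?thesis using H[of S x y] by (auto simp: c_def H_def)
            qed
            thus "(if x \<noteq> y \<and> near j x y then \<omega> * H S x y else 0) \<le> (if near j x y then \<omega> * c j else 0)"
              using \<omega> a by (auto simp: c_def)
          qed
          finally show ?thesis using False by simp
        next
          case True
          thus ?thesis using \<omega> a by (auto simp: c_def intro!: sum_nonneg)
        qed
      qed
      also have "\<dots> = (\<Sum>j<m. \<Sum>y\<in>X. if near j x y then \<omega> * c j else 0)" by (rule sum.swap)
      also have "\<dots> = (\<Sum>j<m. c j)"
      proof (intro sum.cong refl)
        fix j assume "j \<in> {..<m}"
        hence "card {y \<in> X. near j x y} = 2 ^ L" using card_near x by (simp add: X_def)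
        thus "(\<Sum>y\<in>X. if near j x y then \<omega> * c j else 0) = c j"
          using X by (simp add: sum.inter_filter[symmetric] \<omega>_def)
      qed
      also have "\<dots> = (\<Sum>j<m. (if block n L j \<subseteq> S then a else 0) +
          (if block n L j \<inter> S \<noteq> {} \<and> \<not> block n L j \<subseteq> S then 1 else 0))"
        by (intro sum.cong refl) (auto simp: c_def)
      also have "\<dots> = a * card {j. j < m \<and> block n L j \<subseteq> S} +
          card {j. j < m \<and> block n L j \<inter> S \<noteq> {} \<and> \<not> block n L j \<subseteq> S}"
        by (simp add: sum.distrib sum.inter_filter[symmetric] mult.commute)
      also have "\<dots> \<le> R" using cost[OF Sb(2)] by (simp add: m_def)
      finally show ?thesis by (simp add: X_def)
    next
      case False
      \<comment> \<open>A neighbour that matches the query must change every coordinate in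
        \<open>E\<close>. As \<open>E\<close> is nonempty, it determines the block.\<close>
      define E where "E = {i \<in> S. x i \<noteq> b i}"
      have "E \<noteq> {}"
      proof
        assume "E = {}"
        hence "restrict x S = b"
          using Sb(3) by (auto simp: E_def fun_eq_iff sign_strings_def PiE_iff extensional_def)
        thus False using False by simp
      qed
      have E_near: "E \<subseteq> block n L j" if "near j x y" "restrict y S = b" for j y
      proof
        fix i assume i: "i \<in> E"
        hence "y i = b i" using that(2) by (auto simp: E_def)
        hence "i \<in> {1..n}" "x i \<noteq> y i" using i Sn by (auto simp: E_def)
        thus "i \<in> block n L j" using that(1) unfolding near_def by blast
      qed
      have ans: "ans x q \<noteq> ans y q \<longleftrightarrow> restrict y S = b" for y
        using False by (simp add: answer_def Sb)
      show ?thesis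
      proof (cases "\<exists>j<m. E \<subseteq> block n L j")
        case none: False
        have "w x y = 0" if "restrict y S = b" for y
          unfolding w_def using none E_near[OF _ that] by (intro sum.neutral) auto
        hence "(\<Sum>y\<in>X. if ans x q \<noteq> ans y q then w x y * h q x y else 0) = 0"
          unfolding ans by (intro sum.neutral) auto
        thus ?thesis using R0 by (simp add: X_def)
      next
        case True
        then obtain j where j: "j < m" "E \<subseteq> block n L j" by blast
        have uniq: "j' = j" if "near j' x y" "restrict y S = b" for j' y
        proof -
          obtain i where "i \<in> E" using \<open>E \<noteq> {}\<close> by blast
          thus ?thesis using E_near[OF that] j(2) by (intro block_disjoint[of i]) auto
        qed
        have w: "w x y \<le> (if near j x y then \<omega> else 0)" if "restrict y S = b" for y
        proof -
          have "w x y \<le> (\<Sum>j'<m. if j' = j then if near j x y then \<omega> else 0 else 0)"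
            unfolding w_def
          proof (intro sum_mono)
            fix j'
            show "(if x \<noteq> y \<and> near j' x y then \<omega> else 0) \<le> (if j' = j then if near j x y then \<omega> else 0 else 0)"
            proof (cases "near j' x y")
              case True
              hence "j' = j" by (rule uniq[OF _ that])
              thus ?thesis using True \<omega> by simp
            qed (use \<omega> in simp)
          qed
          thus ?thesis using j by simp
        qed
        have "(\<Sum>y\<in>X. if ans x q \<noteq> ans y q then w x y * h q x y else 0) \<le>
            (\<Sum>y\<in>X. if near j x y \<and> restrict y S = b then \<omega> / (if block n L j \<subseteq> S then a else 1) else 0)"
          unfolding ans
        proof (intro sum_mono)
          fix y
          show "(if restrict y S = b then w x y * h q x y else 0) \<le>
              (if near j x y \<and> restrict y S = b then \<omega> / (if block n L j \<subseteq> S then a else 1) else 0)"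
          proof (cases "restrict y S = b")
            case yS: True
            have hq: "h q x y = 1 / H S x y" using False by (simp add: h_def Sb)
            have "H S x y = (if block n L j \<subseteq> S then a else 1)" if "near j x y"
            proof -
              have "full S x y \<longleftrightarrow> block n L j \<subseteq> S"
                unfolding full_def using that j(1) uniq[OF _ yS] by metis
              thus ?thesis by (simp add: H_def)
            qed
            moreover have "w x y * (1 / H S x y) \<le> (if near j x y then \<omega> else 0) * (1 / H S x y)"
              using H[of S x y] by (intro mult_right_mono w[OF yS]) auto
            ultimately show ?thesis using yS unfolding hq by (cases "near j x y") simp_all
          qed simp
        qed
        also have "\<dots> = card {y \<in> X. near j x y \<and> restrict y S = b} * (\<omega> / (if block n L j \<subseteq> S then a else 1))"
          using X by (simp add: sum.inter_filter[symmetric])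
        also have "\<dots> \<le> R"
        proof (cases "block n L j \<subseteq> S")
          case True
          \<comment> \<open>The query fixes all coordinates in which \<open>y\<close> may differ
            from \<open>x\<close>, so there is one candidate: \<open>x\<close> overwritten by
            \<open>b\<close>.\<close>
          have "y = (\<lambda>i. if i \<in> S then b i else x i)" if "y \<in> X" "near j x y" "restrict y S = b" for y
          proof
            fix i
            show "y i = (if i \<in> S then b i else x i)"
            proof (cases "i \<in> S")
              case out: False
              have "x i = y i"
              proof (cases "i \<in> {1..n}")
                case in_range: True
                thus ?thesis using out True that(2) unfolding near_def by blast
              next
                case False
                thus ?thesis using that(1) x by (simp add: X_def sign_strings_def PiE_iff extensional_def)
              qed
              thus ?thesis using out by simp
            qed (use that(3) in auto)
          qed
          hence "card {y \<in> X. near j x y \<and> restrict y S = b} \<le> card {\<lambda>i. if i \<in> S then b i else x i}"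
            by (intro card_mono) auto
          hence "card {y \<in> X. near j x y \<and> restrict y S = b} * (\<omega> / a) \<le> 1 * (\<omega> / a)"
            using \<omega> a by (intro mult_right_mono) auto
          thus ?thesis using R True by (simp add: \<omega>_def)
        next
          case cut: False
          \<comment> \<open>Block \<open>j\<close> is itself a cut block, so \<open>cost\<close>
            forces \<open>1 \<le> R\<close>; counting all \<open>2 ^ L\<close> neighbours is then
            good enough.\<close>
          have "j \<in> {j. j < n div L \<and> block n L j \<inter> S \<noteq> {} \<and> \<not> block n L j \<subseteq> S}"
            using cut j \<open>E \<noteq> {}\<close> by (auto simp: m_def E_def)
          hence "card {j} \<le> card {j. j < n div L \<and> block n L j \<inter> S \<noteq> {} \<and> \<not> block n L j \<subseteq> S}"
            by (intro card_mono) auto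
          moreover have "0 \<le> a * card {j. j < n div L \<and> block n L j \<subseteq> S}" using a by simp
          ultimately have R1: "1 \<le> R" using cost[OF Sb(2)] by simp
          have "card {y \<in> X. near j x y \<and> restrict y S = b} \<le> card {y \<in> X. near j x y}"
            using X by (intro card_mono) auto
          also have "\<dots> = 2 ^ L" using x j(1) by (intro card_near) (simp_all add: X_def)
          finally have "real (card {y \<in> X. near j x y \<and> restrict y S = b}) \<le> 2 ^ L" by simp
          also have "(2::real) ^ L \<le> R * 2 ^ L" using R1 by simp
          finally show ?thesis using cut by (simp add: \<omega>_def divide_le_eq)
        qed
        finally show ?thesis by (simp add: X_def)
      qed
    qed
  qed
  thus ?thesis by (simp add: m_def)
qed

section \<open>Weights by the position of the first difference\<close>

definition first_diff :: "(nat \<Rightarrow> int) \<Rightarrow> (nat \<Rightarrow> int) \<Rightarrow> nat" where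
  "first_diff x y = (LEAST i. x i \<noteq> y i)"

lemma first_diff_commute: "first_diff x y = first_diff y x"
  by (simp add: first_diff_def eq_commute)

lemma first_diff_eq_iff:
  assumes "x \<noteq> y"
  shows "first_diff x y = j \<longleftrightarrow> (\<forall>i<j. x i = y i) \<and> x j \<noteq> y j"
proof
  obtain i where i: "x i \<noteq> y i" using assms by auto
  assume j: "first_diff x y = j"
  have "x j \<noteq> y j"
    unfolding j[symmetric] first_diff_def by (rule LeastI[of "\<lambda>i. x i \<noteq> y i", OF i])
  moreover have "x l = y l" if "l < j" for l
    using not_less_Least[of l "\<lambda>i. x i \<noteq> y i"] that j unfolding first_diff_def by blast
  ultimately show "(\<forall>i<j. x i = y i) \<and> x j \<noteq> y j" by blast
next
  show "first_diff x y = j" if "(\<forall>i<j. x i = y i) \<and> x j \<noteq> y j"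
    using that unfolding first_diff_def by (intro Least_equality) (auto simp: not_less[symmetric])
qed

lemma first_diff_mem:
  assumes "x \<in> sign_strings V" "y \<in> sign_strings V" "x \<noteq> y"
  shows "first_diff x y \<in> V"
  using assms first_diff_eq_iff[of x y "first_diff x y"]
  by (auto simp: sign_strings_def PiE_iff extensional_def)

text \<open>The coordinates up to \<open>j\<close> are forced, those before \<open>j\<close> equal
  to \<open>x\<close> and the one at \<open>j\<close> flipped; the other \<open>n - j\<close> are
  free.\<close>

lemma card_first_diff:
  assumes x: "x \<in> sign_strings {1..n}" and j: "j \<in> {1..n}"
  shows "card {y \<in> sign_strings {1..n}. y \<noteq> x \<and> first_diff x y = j} = 2 ^ (n - j)"
proof -
  have xj: "x j \<in> {-1, 1}" using x j by (auto simp: sign_strings_def PiE_iff)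
  have "{y \<in> sign_strings {1..n}. y \<noteq> x \<and> first_diff x y = j} =
      {y \<in> sign_strings {1..n}. \<forall>i\<in>{1..j}. y i = (x(j := - x j)) i}"
  proof (intro Collect_cong conj_cong refl)
    fix y assume y: "y \<in> sign_strings {1..n}"
    have yj: "y j \<in> {-1, 1}" using y j by (auto simp: sign_strings_def PiE_iff)
    \<comment> \<open>\<open>first_diff\<close> searches all naturals, so position 0, where both
      strings are undefined, has to be excluded separately.\<close>
    have 0: "x 0 = y 0" using x y by (auto simp: sign_strings_def PiE_iff extensional_def)
    show "(y \<noteq> x \<and> first_diff x y = j) = (\<forall>i\<in>{1..j}. y i = (x(j := - x j)) i)"
    proof
      assume "y \<noteq> x \<and> first_diff x y = j"
      hence "\<forall>i<j. x i = y i" "x j \<noteq> y j" using first_diff_eq_iff[of x y j] by auto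
      thus "\<forall>i\<in>{1..j}. y i = (x(j := - x j)) i" using xj yj by auto
    next
      assume *: "\<forall>i\<in>{1..j}. y i = (x(j := - x j)) i"
      hence "y j = - x j" using j by auto
      hence ne: "x j \<noteq> y j" using xj by auto
      moreover have "x i = y i" if "i < j" for i
        using * that 0 by (cases "i = 0") auto
      ultimately show "y \<noteq> x \<and> first_diff x y = j" using first_diff_eq_iff[of x y j] by auto
    qed
  qed
  also have "card \<dots> = 2 ^ card ({1..n} - {1..j})"
    using x j xj by (intro card_cylinder) (auto simp: sign_strings_def PiE_iff extensional_def)
  also have "card ({1..n} - {1..j}) = n - j" using j by (simp add: card_Diff_subset)
  finally show ?thesis .
qed

lemma sum_first_diff:
  assumes x: "x \<in> sign_strings {1..n}"
  shows "(\<Sum>y\<in>sign_strings {1..n}. if y \<noteq> x then f (first_diff x y) else 0) = (\<Sum>j=1..n. 2 ^ (n - j) * f j :: real)"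
proof -
  let ?Y = "{y \<in> sign_strings {1..n}. y \<noteq> x}"
  have fin: "finite (sign_strings {1..n})" by (rule finite_sign_strings) simp
  have "(\<Sum>y\<in>sign_strings {1..n}. if y \<noteq> x then f (first_diff x y) else 0) = (\<Sum>y\<in>?Y. f (first_diff x y))"
    by (rule sum.inter_filter[OF fin, symmetric])
  also have "\<dots> = (\<Sum>j=1..n. \<Sum>y\<in>{y \<in> ?Y. first_diff x y = j}. f (first_diff x y))"
    using fin x first_diff_mem[OF x] by (intro sum.group[symmetric]) auto
  also have "\<dots> = (\<Sum>j=1..n. 2 ^ (n - j) * f j)"
  proof (intro sum.cong refl)
    fix j assume j: "j \<in> {1..n}"
    have "(\<Sum>y\<in>{y \<in> ?Y. first_diff x y = j}. f (first_diff x y)) = (\<Sum>y\<in>{y \<in> ?Y. first_diff x y = j}. f j)"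
      by (intro sum.cong) auto
    also have "{y \<in> ?Y. first_diff x y = j} = {y \<in> sign_strings {1..n}. y \<noteq> x \<and> first_diff x y = j}"
      by auto
    finally show "(\<Sum>y\<in>{y \<in> ?Y. first_diff x y = j}. f (first_diff x y)) = 2 ^ (n - j) * f j"
      using card_first_diff[OF x j] by simp
  qed
  finally show ?thesis .
qed

text \<open>The \<open>2 ^ (n - j)\<close> strings first differing from \<open>x\<close> at
  \<open>j\<close> have total weight 1, so the total is \<open>n\<close>. For a query of length
  \<open>s\<close>, a matching \<open>x\<close> meets the geometric series of
  \<open>2 ^ j / 2 ^ s\<close> over \<open>j \<le> s\<close>, below 2. For any other
  \<open>x\<close> the ratio \<open>h\<close> is chosen so that \<open>w * h\<close> is the constant
  \<open>2 ^ s / 2 ^ n\<close>, and at most \<open>2 ^ (n - s)\<close> strings match.\<close>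

lemma prefix_lower_bound:
  assumes comp: "computes_in n {{1..i} | i. 1 \<le> i \<and> i \<le> n} (sign_strings {1..n}) (\<lambda>x. x) T"
  shows "real n \<le> 80 * real T"
proof -
  define \<Q> where "\<Q> = {{1..i} | i. 1 \<le> i \<and> i \<le> n}"
  have \<Q>: "\<Q> \<subseteq> Pow {1..n}" by (auto simp: \<Q>_def)
  define X where "X = sign_strings {1..n}"
  have X: "finite X" by (simp add: X_def finite_sign_strings)
  define w :: "(nat \<Rightarrow> int) \<Rightarrow> (nat \<Rightarrow> int) \<Rightarrow> real" where "w x y = 2 ^ first_diff x y / 2 ^ n" for x y
  define h :: "nat set \<times> (nat \<Rightarrow> int) \<Rightarrow> (nat \<Rightarrow> int) \<Rightarrow> (nat \<Rightarrow> int) \<Rightarrow> real" where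
    "h q x y = (if restrict x (fst q) = snd q then 2 ^ first_diff x y / 2 ^ card (fst q)
      else 2 ^ card (fst q) / 2 ^ first_diff x y)" for q x y
  have "real n \<le> 40 * 2 * real T"
  proof (rule weighted_adversary_lower_bound[OF \<Q> _ _ _ _ _ _ comp[folded \<Q>_def], of w h])
    show "w x y \<ge> 0" for x y by (simp add: w_def)
    show "w x y = w y x" for x y by (simp add: w_def first_diff_commute)
    show "h q x y > 0" for q x y by (simp add: h_def)
    show "h q y x = 1 / h q x y" if "ans x q \<noteq> ans y q" for q x y
      using that by (auto simp: h_def answer_def first_diff_commute[of y x] split: if_splits)
  next
    fix x assume x: "x \<in> sign_strings {1..n}"
    have "(\<Sum>y\<in>sign_strings {1..n}. if y \<noteq> x then w x y else 0) = (\<Sum>j=1..n. 2 ^ (n - j) * (2 ^ j / 2 ^ n))"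
      unfolding w_def by (rule sum_first_diff[OF x])
    also have "\<dots> = (\<Sum>j=1..n. 1)"
      by (intro sum.cong refl) (simp add: power_add[symmetric])
    finally show "real n \<le> (\<Sum>y\<in>sign_strings {1..n}. if y \<noteq> x then w x y else 0)" by simp
  next
    fix q x assume q: "q \<in> queries \<Q>" and x: "x \<in> sign_strings {1..n}"
    obtain s b where Sb: "q = ({1..s}, b)" "s \<in> {1..n}" "b \<in> sign_strings {1..s}"
      using q by (auto simp: \<Q>_def)
    show "(\<Sum>y\<in>sign_strings {1..n}. if ans x q \<noteq> ans y q then w x y * h q x y else 0) \<le> 2"
    proof (cases "restrict x {1..s} = b")
      case True
      have "(\<Sum>y\<in>X. if ans x q \<noteq> ans y q then w x y * h q x y else 0) \<le>
          (\<Sum>y\<in>X. if y \<noteq> x then (\<lambda>j. if j \<le> s then 2 ^ j / 2 ^ n * (2 ^ j / 2 ^ s) else 0) (first_diff x y) else 0)"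
      proof (intro sum_mono)
        fix y assume y: "y \<in> X"
        have "y \<noteq> x \<and> first_diff x y \<le> s" if "ans x q \<noteq> ans y q"
        proof -
          have "restrict x {1..s} \<noteq> restrict y {1..s}" using that unfolding answer_def Sb by auto
          then obtain i where i: "i \<in> {1..s}" "x i \<noteq> y i" unfolding restrict_eq_iff by blast
          hence "first_diff x y \<le> i" unfolding first_diff_def by (intro Least_le)
          thus ?thesis using i by auto
        qed
        thus "(if ans x q \<noteq> ans y q then w x y * h q x y else 0) \<le>
            (if y \<noteq> x then (\<lambda>j. if j \<le> s then 2 ^ j / 2 ^ n * (2 ^ j / 2 ^ s) else 0) (first_diff x y) else 0)"
          using True by (auto simp: w_def h_def Sb)
      qed
      also have "\<dots> = (\<Sum>j=1..n. 2 ^ (n - j) * (if j \<le> s then 2 ^ j / 2 ^ n * (2 ^ j / 2 ^ s) else 0))"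
        unfolding X_def by (rule sum_first_diff[OF x])
      also have "\<dots> = (\<Sum>j=1..n. if j \<le> s then 2 ^ j / 2 ^ s else 0)"
        by (intro sum.cong refl) (auto simp: power_add[symmetric], simp add: power_add)
      also have "\<dots> = (\<Sum>j=1..s. 2 ^ j) / 2 ^ s"
        using Sb(2) unfolding sum_divide_distrib by (intro sum.mono_neutral_cong_right) auto
      also have "(\<Sum>j=1..s. 2 ^ j :: real) \<le> 2 * 2 ^ s"
        by (induction s) auto
      hence "(\<Sum>j=1..s. 2 ^ j) / 2 ^ s \<le> (2::real)" by (simp add: divide_le_eq)
      finally show ?thesis by (simp add: X_def)
    next
      case False
      have "(\<Sum>y\<in>X. if ans x q \<noteq> ans y q then w x y * h q x y else 0) =
          (\<Sum>y\<in>X. if restrict y {1..s} = b then 2 ^ s / 2 ^ n else 0)"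
        using False by (intro sum.cong refl) (auto simp: answer_def Sb w_def h_def)
      also have "\<dots> = card {y \<in> X. restrict y {1..s} = b} * (2 ^ s / 2 ^ n)"
        using X by (simp add: sum.inter_filter[symmetric])
      also have "card {y \<in> X. restrict y {1..s} = b} \<le> 2 ^ (n - s)"
      proof (cases "{y \<in> X. restrict y {1..s} = b} = {}")
        case False
        then obtain z where z: "z \<in> sign_strings {1..n}" "restrict z {1..s} = b" by (auto simp: X_def)
        have "{y \<in> X. restrict y {1..s} = b} = {y \<in> sign_strings {1..n}. \<forall>i\<in>{1..s}. y i = z i}"
          by (simp add: X_def z(2)[symmetric] restrict_eq_iff)
        also have "card \<dots> = 2 ^ card ({1..n} - {1..s})"
          using Sb(2) z by (intro card_cylinder) auto
        also have "card ({1..n} - {1..s}) = n - s" using Sb(2) by (simp add: card_Diff_subset)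
        finally show ?thesis by (rule eq_imp_le)
      qed (simp only: card.empty)
      hence "real (card {y \<in> X. restrict y {1..s} = b}) \<le> 2 ^ (n - s)" by simp
      hence "card {y \<in> X. restrict y {1..s} = b} * (2 ^ s / 2 ^ n) \<le> 2 ^ (n - s) * (2 ^ s / 2 ^ n :: real)"
        by (intro mult_right_mono) auto
      also have "\<dots> = 1" using Sb(2) by (simp add: power_add[symmetric])
      finally show ?thesis by (simp add: X_def)
    qed
  qed
  thus ?thesis by simp
qed

text \<open>With \<open>L = 1\<close> a set of \<open>k\<close> bits costs \<open>a * k\<close> on
  matching strings and \<open>1 / (2 * a)\<close> on the others; at \<open>a = 1 / sqrt k\<close>
  both are at most \<open>sqrt k\<close>.\<close>

lemma small_sets_lower_bound:
  assumes k: "1 \<le> k" and comp: "computes_in n {S. S \<subseteq> {1..n} \<and> card S \<le> k} (sign_strings {1..n}) (\<lambda>x. x) T"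
  shows "1 / 80 * (real n / sqrt (real k)) \<le> real T"
proof -
  have sq: "sqrt k > 0" "sqrt k * sqrt k = k" "1 \<le> sqrt k" using k by auto
  have "real (n div 1) / 2 \<le> 40 * sqrt k * real T"
  proof (rule block_lower_bound[where a = "1 / sqrt k", OF _ _ _ _ _ _ comp])
    fix S assume "S \<in> {S. S \<subseteq> {1..n} \<and> card S \<le> k}"
    hence S: "S \<subseteq> {1..n}" "card S \<le> k" by auto
    have blk: "block n 1 j = {Suc j}" if "j < n" for j using that by (auto simp: block_def)
    have "Suc ` {j. j < n div 1 \<and> block n 1 j \<subseteq> S} \<subseteq> S" using blk by auto
    hence "card (Suc ` {j. j < n div 1 \<and> block n 1 j \<subseteq> S}) \<le> card S"
      using S by (intro card_mono) (auto intro: finite_subset)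
    hence "card {j. j < n div 1 \<and> block n 1 j \<subseteq> S} \<le> k"
      using S by (simp add: card_image)
    hence "1 / sqrt k * card {j. j < n div 1 \<and> block n 1 j \<subseteq> S} \<le> 1 / sqrt k * k"
      by (intro mult_left_mono) auto
    also have "1 / sqrt k * k = sqrt k" using sq(1) by (simp add: field_simps)
    finally have le: "1 / sqrt k * card {j. j < n div 1 \<and> block n 1 j \<subseteq> S} \<le> sqrt k" .
    have none: "{j. j < n div 1 \<and> block n 1 j \<inter> S \<noteq> {} \<and> \<not> block n 1 j \<subseteq> S} = {}"
      using blk by auto
    show "1 / sqrt k * card {j. j < n div 1 \<and> block n 1 j \<subseteq> S} +
      card {j. j < n div 1 \<and> block n 1 j \<inter> S \<noteq> {} \<and> \<not> block n 1 j \<subseteq> S} \<le> sqrt k"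
      unfolding none using le by simp
  qed (use sq in \<open>auto simp: field_simps\<close>)
  thus ?thesis using sq(1) by (simp add: field_simps)
qed

text \<open>The only block is the whole string, and \<open>a\<close> equals
  \<open>1 / (2 ^ n * a)\<close> at a = 2^(-n/2).\<close>

lemma full_set_lower_bound:
  assumes n: "1 \<le> n" and comp: "computes_in n {{1..n}} (sign_strings {1..n}) (\<lambda>x. x) T"
  shows "1 / 80 * 2 powr (real n / 2) \<le> real T"
proof -
  define N :: real where "N = 2 powr (real n / 2)"
  have N1: "N \<ge> 1" unfolding N_def by (rule ge_one_powr_ge_zero) auto
  have NN: "2 ^ n = N * N" by (simp add: N_def powr_add[symmetric] powr_realpow)
  have "real (n div n) / 2 \<le> 40 * (1 / N) * real T"
  proof (rule block_lower_bound[where a = "1 / N", OF _ n _ _ _ _ comp])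
    show "1 / (2 ^ n * (1 / N)) \<le> 1 / N" using N1 by (simp add: NN)
    fix S assume "S \<in> {{1..n}}"
    hence "block n n j \<subseteq> S" for j by (auto simp: block_def)
    thus "1 / N * card {j. j < n div n \<and> block n n j \<subseteq> S} +
      card {j. j < n div n \<and> block n n j \<inter> S \<noteq> {} \<and> \<not> block n n j \<subseteq> S} \<le> 1 / N"
      using n by simp
  qed (use N1 in auto)
  thus ?thesis using N1 n unfolding N_def[symmetric] by (simp add: field_simps)
qed

text \<open>\<open>L\<close> is the least length with \<open>n < 2 ^ L\<close>. With
  \<open>a = 1 / 2 ^ L\<close> the at most \<open>n\<close> contained blocks cost 1 altogether, the
  at most two cut ones cost 2, and \<open>1 / (2 ^ L * a)\<close> is 1; hence the row bound
  3.\<close>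

lemma interval_lower_bound:
  assumes n: "1 \<le> n"
    and comp: "computes_in n {{i..j} | i j. 1 \<le> i \<and> i \<le> j \<and> j \<le> n} (sign_strings {1..n}) (\<lambda>x. x) T"
  shows "1 / 960 * (real n / (1 + ln (real n)) ^ 1) \<le> real T"
proof -
  obtain l where l: "2 ^ l \<le> n" "n < 2 ^ (l + 1)" using ex_power_ivl1[of 2 n] n by auto
  define L where "L = l + 1"
  have "l < 2 ^ l" by (rule less_exp)
  hence Ln: "L \<le> n" "1 \<le> L" using l unfolding L_def by linarith+
  have "real (n div L) / 2 \<le> 40 * 3 * real T"
  proof (rule block_lower_bound[where a = "1 / 2 ^ L", OF _ Ln(2) _ _ _ _ comp])
    fix S assume "S \<in> {{i..j} | i j. 1 \<le> i \<and> i \<le> j \<and> j \<le> n}"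
    then obtain a b where S: "S = {a..b}" "1 \<le> a" "a \<le> b" "b \<le> n" by blast
    have "card {j. j < n div L \<and> block n L j \<subseteq> S} \<le> card {..<n div L}" by (rule card_mono) auto
    also have "\<dots> \<le> n" by simp
    also have "\<dots> \<le> 2 ^ L" using l by (simp add: L_def)
    finally have "real (card {j. j < n div L \<and> block n L j \<subseteq> S}) \<le> 2 ^ L" by simp
    hence 1: "1 / 2 ^ L * real (card {j. j < n div L \<and> block n L j \<subseteq> S}) \<le> 1" by (simp add: field_simps)
    have "{j. j < n div L \<and> block n L j \<inter> S \<noteq> {} \<and> \<not> block n L j \<subseteq> S} \<subseteq> {(a - 1) div L, (b - 1) div L}"
    proof
      fix j assume "j \<in> {j. j < n div L \<and> block n L j \<inter> S \<noteq> {} \<and> \<not> block n L j \<subseteq> S}"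
      then obtain i i' where i: "i \<in> block n L j" "i \<in> S" and i': "i' \<in> block n L j" "i' \<notin> S" by blast
      have bounds: "i \<in> {j * L + 1..Suc j * L}" "i' \<in> {j * L + 1..Suc j * L}" using i i' by (auto simp: block_def)
      \<comment> \<open>A block with one point inside the interval and one outside contains an
        endpoint of the interval.\<close>
      have "a \<in> {j * L + 1..Suc j * L} \<or> b \<in> {j * L + 1..Suc j * L}" using bounds i' i S by auto
      hence "(a - 1) div L = j \<or> (b - 1) div L = j"
        using S by (auto intro!: div_nat_eqI simp: algebra_simps)
      thus "j \<in> {(a - 1) div L, (b - 1) div L}" by blast
    qed
    hence "card {j. j < n div L \<and> block n L j \<inter> S \<noteq> {} \<and> \<not> block n L j \<subseteq> S} \<le> card {(a - 1) div L, (b - 1) div L}"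
      by (intro card_mono) auto
    also have "\<dots> \<le> 2" by (rule card_insert_le_m1) auto
    finally have "real (card {j. j < n div L \<and> block n L j \<inter> S \<noteq> {} \<and> \<not> block n L j \<subseteq> S}) \<le> 2"
      by simp
    with 1 show "1 / 2 ^ L * card {j. j < n div L \<and> block n L j \<subseteq> S} +
      card {j. j < n div L \<and> block n L j \<inter> S \<noteq> {} \<and> \<not> block n L j \<subseteq> S} \<le> 3" by linarith
  qed (auto simp: divide_le_eq)
  hence T: "real (n div L) \<le> 240 * real T" by simp
  have "real n \<le> 2 * (real (n div L) * real L)"
  proof -
    have "n mod L < L" using Ln by simp
    moreover have "1 \<le> n div L" using Ln by (simp add: Suc_le_eq div_greater_zero_iff)
    hence "L \<le> n div L * L" by simp
    ultimately have "n \<le> 2 * (n div L * L)" using div_mult_mod_eq[of n L] by linarith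
    hence "real n \<le> real (2 * (n div L * L))" by (rule of_nat_mono)
    thus ?thesis by simp
  qed
  also have "\<dots> \<le> 2 * (240 * real T * real L)" using T by (intro mult_left_mono mult_right_mono) auto
  \<comment> \<open>From \<open>2 ^ l \<le> n\<close> and \<open>1 / 2 \<le> ln 2\<close>,
    \<open>l\<close> is at most \<open>2 * ln n\<close>; the remaining 1 in \<open>L = l + 1\<close>
    is absorbed by the constant.\<close>
  also have "\<dots> \<le> 2 * (240 * real T * (2 * (1 + ln n)))"
  proof -
    have "(2::real) ^ l \<le> real n" using of_nat_mono[OF l(1), where 'a = real] by simp
    hence "ln (2 ^ l) \<le> ln (real n)" by (rule ln_mono) simp
    moreover have "real l * ln 2 = ln (2 ^ l)" by (simp add: ln_realpow)
    ultimately have "real l * ln 2 \<le> ln n" by simp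
    moreover have "real l * (1 / 2) \<le> real l * ln 2" using ln2_ge_two_thirds by (intro mult_left_mono) auto
    ultimately have "real L \<le> 2 * (1 + ln n)" by (simp add: L_def)
    thus ?thesis by (intro mult_left_mono) auto
  qed
  also have "\<dots> = 960 * real T * (1 + ln n)" by simp
  finally have "real n \<le> 960 * real T * (1 + ln n)" .
  moreover have "1 + ln n > 0" using n by (simp add: add_pos_nonneg)
  ultimately show ?thesis by (simp add: field_simps)
qed

theorem corollary1p3:
  shows
    "(\<exists>c>0. \<exists>C>0. \<forall>n k::nat. 1 \<le> k \<and> k \<le> n \<longrightarrow>
        ereal (c * (real n / sqrt (real k))) \<le> Q_rec n {S. S \<subseteq> {1..n} \<and> card S \<le> k} \<and>
        Q_rec n {S. S \<subseteq> {1..n} \<and> card S \<le> k} \<le> ereal (C * (real n / sqrt (real k)))) \<and>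
     (\<exists>c>0. \<exists>C>0. \<exists>p q::nat. \<forall>n::nat. 1 \<le> n \<longrightarrow>
        ereal (c * (real n / (1 + ln (real n)) ^ p)) \<le> Q_rec n {{i..j} | i j. 1 \<le> i \<and> i \<le> j \<and> j \<le> n} \<and>
        Q_rec n {{i..j} | i j. 1 \<le> i \<and> i \<le> j \<and> j \<le> n} \<le> ereal (C * (real n * (1 + ln (real n)) ^ q))) \<and>
     (\<exists>c>0. \<exists>C>0. \<forall>n::nat. 1 \<le> n \<longrightarrow>
        ereal (c * real n) \<le> Q_rec n {{1..i} | i. 1 \<le> i \<and> i \<le> n} \<and>
        Q_rec n {{1..i} | i. 1 \<le> i \<and> i \<le> n} \<le> ereal (C * real n)) \<and>
     (\<exists>c>0. \<exists>C>0. \<forall>n::nat. 1 \<le> n \<longrightarrow>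
        ereal (c * 2 powr (real n / 2)) \<le> Q_rec n {{1..n}} \<and>
        Q_rec n {{1..n}} \<le> ereal (C * 2 powr (real n / 2)))"
proof (intro conjI)
  show "\<exists>c>0. \<exists>C>0. \<forall>n k::nat. 1 \<le> k \<and> k \<le> n \<longrightarrow>
      ereal (c * (real n / sqrt (real k))) \<le> Q_rec n {S. S \<subseteq> {1..n} \<and> card S \<le> k} \<and>
      Q_rec n {S. S \<subseteq> {1..n} \<and> card S \<le> k} \<le> ereal (C * (real n / sqrt (real k)))"
  proof (rule exI[of _ "1 / 80"], rule conjI, simp, rule exI[of _ 148], rule conjI, simp, intro allI impI conjI)
    fix n k :: nat assume k: "1 \<le> k \<and> k \<le> n"
    let ?\<Q> = "{S. S \<subseteq> {1..n} \<and> card S \<le> k}"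
    show "ereal (1 / 80 * (real n / sqrt (real k))) \<le> Q_rec n ?\<Q>"
      using k by (intro Q_rec_ge small_sets_lower_bound) auto
    show "Q_rec n ?\<Q> \<le> ereal (148 * (real n / sqrt (real k)))"
      using k by (intro small_sets_upper_bound) auto
  qed
  show "\<exists>c>0. \<exists>C>0. \<exists>p q::nat. \<forall>n::nat. 1 \<le> n \<longrightarrow>
      ereal (c * (real n / (1 + ln (real n)) ^ p)) \<le> Q_rec n {{i..j} | i j. 1 \<le> i \<and> i \<le> j \<and> j \<le> n} \<and>
      Q_rec n {{i..j} | i j. 1 \<le> i \<and> i \<le> j \<and> j \<le> n} \<le> ereal (C * (real n * (1 + ln (real n)) ^ q))"
  \<comment> \<open>Exponents \<open>p = 1\<close> and \<open>q = 0\<close>: one logarithm in the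
    lower bound and none in the upper bound.\<close>
  proof (rule exI[of _ "1 / 960"], rule conjI, simp, rule exI[of _ 148], rule conjI, simp,
      rule exI[of _ 1], rule exI[of _ 0], intro allI impI conjI)
    fix n :: nat assume n: "1 \<le> n"
    let ?\<Q> = "{{i..j} | i j. 1 \<le> i \<and> i \<le> j \<and> j \<le> n}"
    show "ereal (1 / 960 * (real n / (1 + ln (real n)) ^ 1)) \<le> Q_rec n ?\<Q>"
      by (intro Q_rec_ge interval_lower_bound[OF n])
    \<comment> \<open>Singletons are intervals, so the algorithm for sets of size 1 applies.\<close>
    have "S \<in> ?\<Q>" if S: "S \<subseteq> {1..n}" "S \<noteq> {}" "card S \<le> 1" for S
    proof -
      have "card S = 1" using S card_gt_0_iff[of S] finite_subset[OF S(1)] by fastforce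
      then obtain i where "S = {i..i}" by (auto simp: card_1_singleton_iff)
      thus ?thesis using S by fastforce
    qed
    hence "Q_rec n ?\<Q> \<le> ereal (148 * (real n / sqrt (real 1)))"
      using n by (intro small_sets_upper_bound) auto
    thus "Q_rec n ?\<Q> \<le> ereal (148 * (real n * (1 + ln (real n)) ^ 0))" by simp
  qed
  show "\<exists>c>0. \<exists>C>0. \<forall>n::nat. 1 \<le> n \<longrightarrow>
      ereal (c * real n) \<le> Q_rec n {{1..i} | i. 1 \<le> i \<and> i \<le> n} \<and>
      Q_rec n {{1..i} | i. 1 \<le> i \<and> i \<le> n} \<le> ereal (C * real n)"
  proof (rule exI[of _ "1 / 80"], rule conjI, simp, rule exI[of _ 37], rule conjI, simp, intro allI impI conjI)
    fix n :: nat assume n: "1 \<le> n"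
    show "ereal (1 / 80 * real n) \<le> Q_rec n {{1..i} | i. 1 \<le> i \<and> i \<le> n}"
      by (intro Q_rec_ge) (use prefix_lower_bound in fastforce)
    show "Q_rec n {{1..i} | i. 1 \<le> i \<and> i \<le> n} \<le> ereal (37 * real n)"
      by (rule prefix_upper_bound[OF n])
  qed
  show "\<exists>c>0. \<exists>C>0. \<forall>n::nat. 1 \<le> n \<longrightarrow>
      ereal (c * 2 powr (real n / 2)) \<le> Q_rec n {{1..n}} \<and>
      Q_rec n {{1..n}} \<le> ereal (C * 2 powr (real n / 2))"
    by (rule exI[of _ "1 / 80"], rule conjI, simp, rule exI[of _ 37], rule conjI, simp)
       (intro allI impI conjI Q_rec_ge full_set_lower_bound full_set_upper_bound)
qed

end
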